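(* Two Inoue surfaces $S'=U/\Gamma'$, $S''=U/\Gamma''$ are biholomorphic if and only if the subgroups $\Gamma'$, $\Gamma''$ of the group $\mathrm{Aff}(U)$ belong to the same conjugacy class of subgroups of $\mathrm{Aff}(U)$.
   Context: Notation: $\mathbb{N}^*=\{1,2,\dots\}$; $H=\{w\in\mathbb{C}\mid \mathrm{Im}(w)>0\}$; $U=H\times\mathbb{C}\subset\mathbb{C}^2$ with coordinates $(w,z)$; $\mathrm{Aff}(U)$ is the group of complex affine transformations $f$ of $\mathbb{C}^2$ with $f(U)=U$, acting on $U$. For $x,y\in\mathbb{C}^2$, $x\wedge y=x_1y_2-x_2y_1$. An Inoue surface is a quotient $S=U/\Gamma$, where $\Gamma\subset\mathrm{Aff}(U)$ is one of the following groups (each acts properly discontinuously on $U$, and $U\to S$ is the universal covering of the compact complex surface $S$). Type I. A number $\beta\in\mathbb{C}\setminus\mathbb{R}$ with $|\beta|<1$ is admissible if $|\beta|^{-2},\beta,\bar\beta$ are the roots of a polynomial $X^3-\theta_2X^2+\theta_1X-1$ with $\theta_1,\theta_2\in\mathbb{Z}$. A pair $(a,b)\in\mathbb{R}^3\times\mathbb{C}^3$ is $\beta$-compatible if $a,b,\bar b$ are linearly independent over $\mathbb{C}$ and, $P$ being the matrix with columns $a,b,\bar b$, $P\,\mathrm{diag}(|\beta|^{-2},\beta,\bar\beta)\,P^{-1}\in M_3(\mathbb{Z})$. Then $\Gamma=G(\beta,a,b)$ is generated by $g_0:(w,z)\mapsto(|\beta|^{-2}w,\beta z)$ and $g_i:(w,z)\mapsto(w+a_i,z+b_i)$,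 $1\le i\le3$. Type II. $\alpha=\frac{\theta+\sqrt{\theta^2-4}}{2}$ with $\theta\in\mathbb{Z}$, $\theta\ge3$; $(a,b)\in\mathbb{R}^2\times\mathbb{R}^2$ is a linearly independent pair such that, $P$ being the matrix with columns $a,b$, $N=(n_{ij}):=P\,\mathrm{diag}(\alpha,\alpha^{-1})P^{-1}\in M_2(\mathbb{Z})$; $r\in\mathbb{N}^*$; $c\in\mathbb{R}^2$ satisfies $$(I_2-N)\Big(c-\tfrac12\begin{pmatrix}a_1b_1\\ a_2b_2\end{pmatrix}\Big)-\tfrac{b\wedge a}{2}\begin{pmatrix}n_{11}n_{12}\\ n_{21}n_{22}\end{pmatrix}\in\tfrac{b\wedge a}{r}\mathbb{Z}^2;$$ $t\in\mathbb{C}$. Then $\Gamma=G(\alpha,a,b,c,r,t)$ is generated by $g_0:(w,z)\mapsto(\alpha w,z+t)$, $g_i:(w,z)\mapsto(w+a_i,z+b_iw+c_i)$ ($i=1,2$), $g_3:(w,z)\mapsto(w,z+\frac{b\wedge a}{r})$. Type III. $\alpha=\frac{\theta+\sqrt{\theta^2+4}}{2}$ with $\theta\in\mathbb{N}^*$; $(a,b)\in\mathbb{R}^2\times\mathbb{R}^2$ is a linearly independent pair such that, with $P$ as for type II, $N=(n_{ij}):=P\,\mathrm{diag}(\alpha,-\alpha^{-1})P^{-1}\in M_2(\mathbb{Z})$; $r\in\mathbb{N}^*$; $c\in\mathbb{R}^2$ satisfies $$(I_2+N)\Big(c-\tfrac12\begin{pmatrix}a_1b_1\\ a_2b_2\end{pmatrix}\Big)-\tfrac{a\wedge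 b}{2}\begin{pmatrix}n_{11}n_{12}\\ n_{21}n_{22}\end{pmatrix}\in\tfrac{a\wedge b}{r}\mathbb{Z}^2.$$ Then $\Gamma=G(\alpha,a,b,c,r)$ is generated by $g_0:(w,z)\mapsto(\alpha w,-z)$ and $g_1,g_2,g_3$ given by the same formulae as for type II. *)

theory Defs
  imports "HOL-Analysis.Analysis" "HOL-Computational_Algebra.Polynomial" "HOL-Algebra.Generated_Groups"
begin

section \<open>Complex surfaces and biholomorphisms\<close>

text \<open>The matrix J below is the complex Jacobian: the real derivative is required to be
  complex linear.\<close>

definition complex_differentiable_at :: "(complex^2 \<Rightarrow> complex^2) \<Rightarrow> complex^2 \<Rightarrow> bool" where
  "complex_differentiable_at f p \<longleftrightarrow>
     (\<exists>J :: complex^2^2. (f has_derivative (\<lambda>h. J *v h)) (at p))"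

text \<open>A chart is a pair (V, \<phi>) of a coordinate domain and a coordinate map,
  of which only the values on V matter.\<close>

record 'a surface =
  surface_topology :: "'a topology"
  surface_atlas :: "('a set \<times> ('a \<Rightarrow> complex^2)) set"

text \<open>Continuity makes the set \<phi> ` {x \<in> V. F x \<in> V'} of points tested below open in
  \<open>\<complex>\<^sup>2\<close>, so that the local expression of F is defined near each of them.\<close>

definition holomorphic_map :: "'a surface \<Rightarrow> 'b surface \<Rightarrow> ('a \<Rightarrow> 'b) \<Rightarrow> bool" where
  "holomorphic_map S S' F \<longleftrightarrow>
     continuous_map (surface_topology S) (surface_topology S') F \<and>
     (\<forall>(V, \<phi>) \<in> surface_atlas S. \<forall>(V', \<psi>) \<in> surface_atlas S'.
        \<forall>p \<in> \<phi> ` {x \<in> V. F x \<in> V'}.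
          complex_differentiable_at (\<psi> \<circ> F \<circ> inv_into V \<phi>) p)"

definition biholomorphic :: "'a surface \<Rightarrow> 'b surface \<Rightarrow> bool" where
  "biholomorphic S S' \<longleftrightarrow>
     (\<exists>F G. holomorphic_map S S' F \<and> holomorphic_map S' S G \<and>
        (\<forall>x \<in> topspace (surface_topology S). G (F x) = x) \<and>
        (\<forall>y \<in> topspace (surface_topology S'). F (G y) = y))"


section \<open>The domain U and its affine transformations\<close>

definition UU :: "(complex^2) set" where
  "UU = {p. Im (p$1) > 0}"

text \<open>Elements of \<open>Aff(U)\<close> are kept as maps of \<open>\<complex>\<^sup>2\<close>.\<close>

definition AffU :: "(complex^2 \<Rightarrow> complex^2) monoid" where
  "AffU = \<lparr>carrier = {f. (\<exists>(A :: complex^2^2) v. invertible A \<and> f = (\<lambda>p. A *v p + v)) \<and> f ` UU = UU},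
           mult = (\<circ>), one = id\<rparr>"

definition conjugate_subgroups :: "('a, 'b) monoid_scheme \<Rightarrow> 'a set \<Rightarrow> 'a set \<Rightarrow> bool" where
  "conjugate_subgroups G H K \<longleftrightarrow>
     subgroup H G \<and> subgroup K G \<and>
     (\<exists>g \<in> carrier G. K = (g <#\<^bsub>G\<^esub> H) #>\<^bsub>G\<^esub> (inv\<^bsub>G\<^esub> g))"


section \<open>Quotients of U\<close>

definition orbit_proj :: "(complex^2 \<Rightarrow> complex^2) set \<Rightarrow> complex^2 \<Rightarrow> (complex^2) set" where
  "orbit_proj \<Gamma> p = {g p |g. g \<in> \<Gamma>}"

definition quotient_topology :: "(complex^2 \<Rightarrow> complex^2) set \<Rightarrow> (complex^2) set topology" where
  "quotient_topology \<Gamma> =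
     topology (\<lambda>T. T \<subseteq> orbit_proj \<Gamma> ` UU \<and> open {p \<in> UU. orbit_proj \<Gamma> p \<in> T})"

text \<open>The charts are the inverses of the restrictions of the projection to the open subsets of U
  on which it is injective; if the action is free and properly discontinuous, this is
  the complex structure for which the projection is locally biholomorphic.\<close>

definition quotient_surface :: "(complex^2 \<Rightarrow> complex^2) set \<Rightarrow> (complex^2) set surface" where
  "quotient_surface \<Gamma> =
     \<lparr>surface_topology = quotient_topology \<Gamma>,
      surface_atlas = {(orbit_proj \<Gamma> ` W, inv_into W (orbit_proj \<Gamma>)) |W.
                         open W \<and> W \<subseteq> UU \<and> inj_on (orbit_proj \<Gamma>) W}\<rparr>"


section \<open>The groups of Inoue surfaces\<close>

definition wedge :: "'a::comm_ring_1^2 \<Rightarrow> 'a^2 \<Rightarrow> 'a" (infixl "\<and>\<^sub>w" 75) where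
  "x \<and>\<^sub>w y = x$1 * y$2 - x$2 * y$1"

text \<open>Linear independence of a family, hence the distinctness requirement.\<close>

definition lin_indep :: "('a::field^'n) list \<Rightarrow> bool" where
  "lin_indep vs \<longleftrightarrow> distinct vs \<and> vec.independent (set vs)"

definition diag_mat :: "'a::zero^'n \<Rightarrow> 'a^'n^'n" where
  "diag_mat d = (\<chi> i j. if i = j then d$i else 0)"

definition integral_mat :: "'a::ring_1^'n^'m \<Rightarrow> bool" where
  "integral_mat A \<longleftrightarrow> (\<forall>i j. A$i$j \<in> \<int>)"

text \<open>\<open>vector\<close> lists the rows of a matrix.\<close>

abbreviation matrix_of_columns where
  "matrix_of_columns vs \<equiv> transpose (vector vs)"

definition conj_diag :: "'a::field^'n^'n \<Rightarrow> 'a^'n \<Rightarrow> 'a^'n^'n" where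
  "conj_diag P d = P ** diag_mat d ** matrix_inv P"

subsection \<open>Type I\<close>

text \<open>The three numbers below are distinct, so that equality of sets of roots
  accounts for multiplicities.\<close>

definition admissible :: "complex \<Rightarrow> bool" where
  "admissible \<beta> \<longleftrightarrow> \<beta> \<notin> \<real> \<and> cmod \<beta> < 1 \<and>
     (\<exists>\<theta>\<^sub>1 \<theta>\<^sub>2 :: int.
        {x. poly [:-1, of_int \<theta>\<^sub>1, - of_int \<theta>\<^sub>2, 1:] x = 0} =
        {of_real (1 / (cmod \<beta>)\<^sup>2), \<beta>, cnj \<beta>})"

definition compatible_columns :: "real^3 \<Rightarrow> complex^3 \<Rightarrow> (complex^3) list" where
  "compatible_columns a b = [\<chi> i. of_real (a$i), b, \<chi> i. cnj (b$i)]"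

definition compatible :: "complex \<Rightarrow> real^3 \<Rightarrow> complex^3 \<Rightarrow> bool" where
  "compatible \<beta> a b \<longleftrightarrow>
     lin_indep (compatible_columns a b) \<and>
     integral_mat (conj_diag (matrix_of_columns (compatible_columns a b))
       (vector [of_real (1 / (cmod \<beta>)\<^sup>2), \<beta>, cnj \<beta>]))"

definition group_I :: "complex \<Rightarrow> real^3 \<Rightarrow> complex^3 \<Rightarrow> (complex^2 \<Rightarrow> complex^2) set" where
  "group_I \<beta> a b = generate AffU
     (insert (\<lambda>p. vector [of_real (1 / (cmod \<beta>)\<^sup>2) * p$1, \<beta> * p$2])
        (range (\<lambda>i::3. \<lambda>p. vector [p$1 + of_real (a$i), p$2 + b$i])))"

definition inoue_I :: "(complex^2 \<Rightarrow> complex^2) set \<Rightarrow> bool" where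
  "inoue_I \<Gamma> \<longleftrightarrow>
     (\<exists>\<beta> a b. admissible \<beta> \<and> compatible \<beta> a b \<and> \<Gamma> = group_I \<beta> a b)"

subsection \<open>Types II and III\<close>

text \<open>The generators \<open>g\<^sub>1, g\<^sub>2, g\<^sub>3\<close> common to both types.\<close>

definition unipotent_gens ::
    "real^2 \<Rightarrow> real^2 \<Rightarrow> real^2 \<Rightarrow> nat \<Rightarrow> (complex^2 \<Rightarrow> complex^2) set" where
  "unipotent_gens a b c r =
     insert (\<lambda>p. vector [p$1, p$2 + of_real (b \<and>\<^sub>w a / of_nat r)])
       (range (\<lambda>i::2. \<lambda>p. vector [p$1 + of_real (a$i), p$2 + of_real (b$i) * p$1 + of_real (c$i)]))"

definition group_II ::
    "real \<Rightarrow> real^2 \<Rightarrow> real^2 \<Rightarrow> real^2 \<Rightarrow> nat \<Rightarrow> complex \<Rightarrow> (complex^2 \<Rightarrow> complex^2) set" where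
  "group_II \<alpha> a b c r t = generate AffU
     (insert (\<lambda>p. vector [of_real \<alpha> * p$1, p$2 + t]) (unipotent_gens a b c r))"

definition group_III ::
    "real \<Rightarrow> real^2 \<Rightarrow> real^2 \<Rightarrow> real^2 \<Rightarrow> nat \<Rightarrow> (complex^2 \<Rightarrow> complex^2) set" where
  "group_III \<alpha> a b c r = generate AffU
     (insert (\<lambda>p. vector [of_real \<alpha> * p$1, - p$2]) (unipotent_gens a b c r))"

definition inoue_II :: "(complex^2 \<Rightarrow> complex^2) set \<Rightarrow> bool" where
  "inoue_II \<Gamma> \<longleftrightarrow>
     (\<exists>(\<theta>::int) (\<alpha>::real) (a::real^2) (b::real^2) (c::real^2) (r::nat) (t::complex) (N::real^2^2).
        \<theta> \<ge> 3 \<and> \<alpha> = (of_int \<theta> + sqrt ((of_int \<theta>)\<^sup>2 - 4)) / 2 \<and>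
        lin_indep [a, b] \<and>
        N = conj_diag (matrix_of_columns [a, b]) (vector [\<alpha>, 1 / \<alpha>]) \<and> integral_mat N \<and>
        r \<ge> 1 \<and>
        (\<exists>k :: int^2.
           (mat 1 - N) *v (c - (1/2) *s (\<chi> i. a$i * b$i))
             - (b \<and>\<^sub>w a / 2) *s vector [N$1$1 * N$1$2, N$2$1 * N$2$2]
           = (b \<and>\<^sub>w a / of_nat r) *s (\<chi> i. of_int (k$i))) \<and>
        \<Gamma> = group_II \<alpha> a b c r t)"

definition inoue_III :: "(complex^2 \<Rightarrow> complex^2) set \<Rightarrow> bool" where
  "inoue_III \<Gamma> \<longleftrightarrow>
     (\<exists>(\<theta>::int) (\<alpha>::real) (a::real^2) (b::real^2) (c::real^2) (r::nat) (N::real^2^2).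
        \<theta> \<ge> 1 \<and> \<alpha> = (of_int \<theta> + sqrt ((of_int \<theta>)\<^sup>2 + 4)) / 2 \<and>
        lin_indep [a, b] \<and>
        N = conj_diag (matrix_of_columns [a, b]) (vector [\<alpha>, - (1 / \<alpha>)]) \<and> integral_mat N \<and>
        r \<ge> 1 \<and>
        (\<exists>k :: int^2.
           (mat 1 + N) *v (c - (1/2) *s (\<chi> i. a$i * b$i))
             - (a \<and>\<^sub>w b / 2) *s vector [N$1$1 * N$1$2, N$2$1 * N$2$2]
           = (a \<and>\<^sub>w b / of_nat r) *s (\<chi> i. of_int (k$i))) \<and>
        \<Gamma> = group_III \<alpha> a b c r)"

definition inoue_group :: "(complex^2 \<Rightarrow> complex^2) set \<Rightarrow> bool" where
  "inoue_group \<Gamma> \<longleftrightarrow> inoue_I \<Gamma> \<or> inoue_II \<Gamma> \<or> inoue_III \<Gamma>"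


section \<open>Well-definedness\<close>

lemma openin_quotient_topology:
  "openin (quotient_topology \<Gamma>) T \<longleftrightarrow>
     T \<subseteq> orbit_proj \<Gamma> ` UU \<and> open {p \<in> UU. orbit_proj \<Gamma> p \<in> T}"
proof -
  have "istopology (\<lambda>T. T \<subseteq> orbit_proj \<Gamma> ` UU \<and> open {p \<in> UU. orbit_proj \<Gamma> p \<in> T})"
    unfolding istopology_def
  proof (intro conjI allI impI)
    fix S T
    assume "S \<subseteq> orbit_proj \<Gamma> ` UU \<and> open {p \<in> UU. orbit_proj \<Gamma> p \<in> S}"
      and "T \<subseteq> orbit_proj \<Gamma> ` UU \<and> open {p \<in> UU. orbit_proj \<Gamma> p \<in> T}"
    moreover have "{p \<in> UU. orbit_proj \<Gamma> p \<in> S \<inter> T} =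
        {p \<in> UU. orbit_proj \<Gamma> p \<in> S} \<inter> {p \<in> UU. orbit_proj \<Gamma> p \<in> T}" by blast
    ultimately show "S \<inter> T \<subseteq> orbit_proj \<Gamma> ` UU" "open {p \<in> UU. orbit_proj \<Gamma> p \<in> S \<inter> T}"
      by (auto simp del: Int_iff)
  next
    fix K
    assume K: "\<forall>T\<in>K. T \<subseteq> orbit_proj \<Gamma> ` UU \<and> open {p \<in> UU. orbit_proj \<Gamma> p \<in> T}"
    have "{p \<in> UU. orbit_proj \<Gamma> p \<in> \<Union> K} = (\<Union>T\<in>K. {p \<in> UU. orbit_proj \<Gamma> p \<in> T})" by blast
    with K show "\<Union> K \<subseteq> orbit_proj \<Gamma> ` UU" "open {p \<in> UU. orbit_proj \<Gamma> p \<in> \<Union> K}"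
      by auto
  qed
  then show ?thesis
    by (simp add: quotient_topology_def topology_inverse')
qed

lemma group_AffU: "group AffU"
proof (rule groupI)
  fix f g assume f: "f \<in> carrier AffU" and g: "g \<in> carrier AffU"
  obtain A v B w where A: "invertible (A :: complex^2^2)" "f = (\<lambda>p. A *v p + v)"
    and B: "invertible (B :: complex^2^2)" "g = (\<lambda>p. B *v p + w)"
    using f g by (auto simp: AffU_def)
  have "f \<circ> g = (\<lambda>p. (A ** B) *v p + (A *v w + v))"
    by (auto simp: A B matrix_vector_right_distrib matrix_vector_mul_assoc add.assoc)
  moreover have "(f \<circ> g) ` UU = UU"
    unfolding image_comp [symmetric] using f g by (simp add: AffU_def)
  ultimately show "f \<otimes>\<^bsub>AffU\<^esub> g \<in> carrier AffU"
    using invertible_mult [OF A(1) B(1)] by (auto simp: AffU_def)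
next
  have "(id :: complex^2 \<Rightarrow> _) = (\<lambda>p. mat 1 *v p + 0)" by auto
  moreover have "invertible (mat 1 :: complex^2^2)"
    by (simp add: invertible_det_nz)
  ultimately have "\<exists>(A :: complex^2^2) v. invertible A \<and> id = (\<lambda>p. A *v p + v)" by blast
  then show "\<one>\<^bsub>AffU\<^esub> \<in> carrier AffU" by (simp add: AffU_def)
next
  fix f assume f: "f \<in> carrier AffU"
  obtain A v where A: "invertible (A :: complex^2^2)" "f = (\<lambda>p. A *v p + v)"
    using f by (auto simp: AffU_def)
  obtain B :: "complex^2^2" where B: "A ** B = mat 1" "B ** A = mat 1"
    using A(1) by (auto simp: invertible_def)
  define g where "g = (\<lambda>p. B *v p + - (B *v v))"
  have gf: "g \<circ> f = id"
    by (auto simp: A g_def matrix_vector_right_distrib matrix_vector_mul_assoc B)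
  have "invertible B" using B by (auto simp: invertible_def)
  moreover have "g ` UU = UU"
  proof -
    have "g ` UU = (g \<circ> f) ` UU"
      unfolding image_comp [symmetric] using f by (simp add: AffU_def)
    then show ?thesis by (simp add: gf)
  qed
  ultimately have "g \<in> carrier AffU" using g_def unfolding AffU_def by fastforce
  with gf show "\<exists>g\<in>carrier AffU. g \<otimes>\<^bsub>AffU\<^esub> f = \<one>\<^bsub>AffU\<^esub>"
    by (auto simp: AffU_def)
qed (auto simp: AffU_def comp_assoc)

lemma AffU_memI:
  assumes "\<And>p. f p = vector [of_real x * p$1 + of_real s, y * p$1 + z * p$2 + u]"
    and "x > 0" and "z \<noteq> 0"
  shows "f \<in> carrier AffU"
proof -
  define A :: "complex^2^2" where "A = vector [vector [of_real x, 0], vector [y, z]]"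
  define v :: "complex^2" where "v = vector [of_real s, u]"
  have det: "invertible A"
    using assms(2,3) by (simp add: invertible_det_nz det_2 A_def)
  have f: "f = (\<lambda>p. A *v p + v)"
    by (auto simp: assms(1) A_def v_def vec_eq_iff forall_2 matrix_vector_mult_def sum_2)
  have "q \<in> f ` UU" if "q \<in> UU" for q
  proof -
    define p1 where "p1 = (q$1 - of_real s) / of_real x"
    have "q = f (vector [p1, (q$2 - u - y * p1) / z])"
      using assms(2,3) by (simp add: assms(1) p1_def vec_eq_iff forall_2)
    moreover have "vector [p1, (q$2 - u - y * p1) / z] \<in> UU"
      using that assms(2) by (simp add: UU_def p1_def)
    ultimately show ?thesis by blast
  qed
  moreover have "f p \<in> UU" if "p \<in> UU" for p
    using that assms(2) by (simp add: UU_def assms(1))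
  ultimately show ?thesis
    using det f by (auto simp: AffU_def)
qed

lemma unipotent_gens_AffU: "unipotent_gens a b c r \<subseteq> carrier AffU"
proof -
  have "(\<lambda>p. vector [p$1, p$2 + of_real (b \<and>\<^sub>w a / of_nat r)]) \<in> carrier AffU"
    by (rule AffU_memI [where x = 1 and s = 0 and y = 0 and z = 1]) auto
  moreover have "(\<lambda>p. vector [p$1 + of_real (a$i), p$2 + of_real (b$i) * p$1 + of_real (c$i)])
      \<in> carrier AffU" for i
    by (rule AffU_memI [where x = 1 and s = "a$i" and y = "of_real (b$i)" and z = 1])
       (auto simp: add_ac)
  ultimately show ?thesis by (auto simp: unipotent_gens_def)
qed

lemma inoue_group_subgroup:
  assumes "inoue_group \<Gamma>"
  shows "subgroup \<Gamma> AffU"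
proof -
  interpret group AffU by (rule group_AffU)
  have "subgroup \<Gamma> AffU" if "inoue_I \<Gamma>"
  proof -
    from that obtain \<beta> a b where ad: "admissible \<beta>" and \<Gamma>: "\<Gamma> = group_I \<beta> a b"
      by (auto simp: inoue_I_def)
    have "\<beta> \<noteq> 0" using ad by (auto simp: admissible_def)
    then have "(\<lambda>p. vector [of_real (1 / (cmod \<beta>)\<^sup>2) * p$1, \<beta> * p$2]) \<in> carrier AffU"
      by (intro AffU_memI [where x = "1 / (cmod \<beta>)\<^sup>2" and s = 0 and y = 0 and z = \<beta> and u = 0]) auto
    moreover have "(\<lambda>p. vector [p$1 + of_real (a$i), p$2 + b$i]) \<in> carrier AffU" for i
      by (rule AffU_memI [where x = 1 and s = "a$i" and y = 0 and z = 1]) auto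
    ultimately show ?thesis
      unfolding \<Gamma> group_I_def by (intro generate_is_subgroup) auto
  qed
  moreover have "subgroup \<Gamma> AffU" if "inoue_II \<Gamma>"
  proof -
    from that obtain \<theta> :: int and \<alpha> a b c r t where "\<theta> \<ge> 3"
      and \<alpha>: "\<alpha> = (of_int \<theta> + sqrt ((of_int \<theta>)\<^sup>2 - 4)) / 2" and \<Gamma>: "\<Gamma> = group_II \<alpha> a b c r t"
      unfolding inoue_II_def by blast
    have "3\<^sup>2 \<le> (of_int \<theta> :: real)\<^sup>2" using \<open>\<theta> \<ge> 3\<close> by (intro power_mono) auto
    then have "\<alpha> > 0" using \<open>\<theta> \<ge> 3\<close> unfolding \<alpha>
      by (intro divide_pos_pos add_pos_nonneg) auto
    then have "(\<lambda>p. vector [of_real \<alpha> * p$1, p$2 + t]) \<in> carrier AffU"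
      by (intro AffU_memI [where x = \<alpha> and s = 0 and y = 0 and z = 1]) auto
    then show ?thesis
      unfolding \<Gamma> group_II_def using unipotent_gens_AffU by (intro generate_is_subgroup) auto
  qed
  moreover have "subgroup \<Gamma> AffU" if "inoue_III \<Gamma>"
  proof -
    from that obtain \<theta> :: int and \<alpha> a b c r where "\<theta> \<ge> 1"
      and \<alpha>: "\<alpha> = (of_int \<theta> + sqrt ((of_int \<theta>)\<^sup>2 + 4)) / 2" and \<Gamma>: "\<Gamma> = group_III \<alpha> a b c r"
      unfolding inoue_III_def by blast
    have "\<alpha> > 0" using \<open>\<theta> \<ge> 1\<close> unfolding \<alpha>
      by (intro divide_pos_pos add_pos_nonneg) auto
    then have "(\<lambda>p. vector [of_real \<alpha> * p$1, - p$2]) \<in> carrier AffU"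
      by (intro AffU_memI [where x = \<alpha> and s = 0 and y = 0 and z = "-1" and u = 0]) auto
    then show ?thesis
      unfolding \<Gamma> group_III_def using unipotent_gens_AffU by (intro generate_is_subgroup) auto
  qed
  ultimately show ?thesis using assms by (auto simp: inoue_group_def)
qed

end

theory Submission
  imports Defs "HOL-Complex_Analysis.Conformal_Mappings"
begin

text \<open>All Inoue groups act freely and properly discontinuously, so a biholomorphic map of the
  quotients lifts to a biholomorphic map \<open>\<Phi>\<close> of U that conjugates one group into the other.
  By Liouville's theorem \<open>\<Phi>\<close> has the form \<open>(w, z) \<mapsto> (\<phi>(w), A(w) z + B(w))\<close>. Every Inoue group contains
  an element acting on w as a translation by some \<open>x \<noteq> 0\<close>, with z-coefficient 1, and an element
  \<open>(w, z) \<mapsto> (l w, \<kappa> z + t)\<close> with \<open>l > 1\<close> and \<open>\<kappa> \<noteq> l\<^sup>2\<close>. Hence each of \<open>\<phi>''/\<phi>'\<close>, \<open>A'/A\<close>, \<open>B''\<close> is a function f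
  with \<open>f(w + x) = f(w)\<close> and \<open>f(l w) = \<mu> f(w)\<close> for some \<open>\<mu> \<noteq> 1\<close>. Such an f has the arbitrarily small
  periods \<open>x / l\<^sup>n\<close>, so it is constant and therefore zero, and \<open>\<Phi>\<close> is affine.\<close>

section \<open>Fibred automorphisms of U\<close>

text \<open>The obstacle is that the images of the two distinguished elements are known only as
  triangular affine maps with unknown coefficients. Hence functions are chosen in which these
  coefficients cancel: differentiation removes additive constants and logarithmic derivatives remove
  multipliers, leaving the factor 1/m under w -> m w, where m is the scaling factor in the source
  group. For B this works only after A is known to be constant, which forces the multipliers of the
  z-coordinate to be 1 and \<kappa>; then the second derivative of B acquires \<kappa>/m^2, and this
  is the origin of the condition \<kappa> \<noteq> m^2. The other difficulty is discontinuity,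
  because the groups are given by generators. Each is placed inside the product of a discrete group
  whose elements preserve Im w with the powers of g_0, which multiply Im w by powers of a number
  above 1. For types II and III the arithmetic condition on c is what makes g_0 normalise such a
  discrete group.\<close>

lemma UU_iff [simp]: "p \<in> UU \<longleftrightarrow> Im (p$1) > 0"
  by (simp add: UU_def)

lemma open_halfplane: "open {w. 0 < Im w}"
  using open_halfspace_Im_gt [of 0] by simp

lemma convex_halfplane: "convex {w. 0 < Im w}"
  using convex_halfspace_Im_gt [of 0] by simp

lemma vector_2_eta: "vector [p$1, p$2] = (p :: 'a::zero^2)"
  by (simp add: vec_eq_iff forall_2)

lemma vector_2_eq_iff [simp]: "vector [x, y] = (vector [x', y'] :: 'a::zero^2) \<longleftrightarrow> x = x' \<and> y = y'"
  by (auto simp: vec_eq_iff forall_2)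

lemma quasi_periodic_zero:
  fixes f :: "complex \<Rightarrow> complex" and a l :: real
  assumes hol: "f holomorphic_on {w. 0 < Im w}"
    and "a \<noteq> 0" "l > 1" "\<mu> \<noteq> 0" "\<mu> \<noteq> 1"
    and per: "\<And>w. 0 < Im w \<Longrightarrow> f (w + of_real a) = f w"
    and scl: "\<And>w. 0 < Im w \<Longrightarrow> f (of_real l * w) = \<mu> * f w"
    and w: "0 < Im w"
  shows "f w = 0"
proof -
  have small: "f (w + of_real (a / l ^ n)) = f w" if "0 < Im w" for w n
    using that
  proof (induction n arbitrary: w)
    case 0
    then show ?case using per by simp
  next
    case (Suc n)
    \<comment> \<open>Multiplication by \<open>l\<close> turns the step \<open>a / l ^ Suc n\<close>
      into \<open>a / l ^ n\<close>, where the induction hypothesis applies; then \<mu>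
      cancels.\<close>
    have "\<mu> * f (w + of_real (a / l ^ Suc n)) = f (of_real l * w + of_real (a / l ^ n))"
      using scl [of "w + of_real (a / l ^ Suc n)"] Suc.prems \<open>l > 1\<close>
      by (simp add: algebra_simps)
    also have "\<dots> = f (of_real l * w)"
      using Suc.IH [of "of_real l * w"] Suc.prems \<open>l > 1\<close> by simp
    also have "\<dots> = \<mu> * f w"
      using scl Suc.prems by simp
    finally show ?case using \<open>\<mu> \<noteq> 0\<close> by simp
  qed
  have D: "(f has_field_derivative 0) (at w)" if "0 < Im w" for w
  proof -
    have d: "(f has_field_derivative deriv f w) (at w)"
      using holomorphic_derivI [OF hol open_halfplane] that by simp
    \<comment> \<open>The difference quotients of \<open>f\<close> along these periods are all zero,
      hence so is their limit, the derivative.\<close>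
    define h :: "nat \<Rightarrow> complex" where "h n = of_real (a / l ^ n)" for n
    have "(\<lambda>n. a / l ^ n) \<longlonglongrightarrow> 0"
      using LIMSEQ_divide_realpow_zero [OF \<open>l > 1\<close>] .
    then have "(\<lambda>n. complex_of_real (a / l ^ n)) \<longlonglongrightarrow> of_real 0"
      by (rule tendsto_of_real)
    then have "h \<longlonglongrightarrow> 0"
      by (simp add: h_def [abs_def])
    then have "filterlim h (at 0) sequentially"
      using \<open>a \<noteq> 0\<close> \<open>l > 1\<close> by (intro filterlim_atI) (auto simp: h_def)
    with d have "(\<lambda>n. (f (w + h n) - f w) / h n) \<longlonglongrightarrow> deriv f w"
      unfolding DERIV_def by (rule filterlim_compose)
    moreover have "(\<lambda>n. (f (w + h n) - f w) / h n) = (\<lambda>n. 0)"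
      using small [OF that] by (simp add: h_def)
    ultimately have "deriv f w = 0"
      using LIMSEQ_unique tendsto_const by metis
    with d show ?thesis by simp
  qed
  obtain c where c: "\<And>w. w \<in> {w. 0 < Im w} \<Longrightarrow> f w = c"
    using has_field_derivative_zero_constant [OF convex_halfplane, of f] D
    by (metis mem_Collect_eq has_field_derivative_at_within)
  have "c = \<mu> * c"
    using scl [OF w] c [of w] c [of "of_real l * w"] w \<open>l > 1\<close> by simp
  then show ?thesis using c w \<open>\<mu> \<noteq> 1\<close> by simp
qed

text \<open>The continuous inverse makes \<open>f\<close> proper, and a proper entire function is a
  polynomial. Injectivity leaves its derivative without zeros, so by the fundamental theorem of
  algebra the derivative is a nonzero constant.\<close>

lemma entire_homeomorphism_affine:
  fixes f g :: "complex \<Rightarrow> complex"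
  assumes hol: "f holomorphic_on UNIV" and "continuous_on UNIV g"
    and gf: "\<And>z. g (f z) = z" and fg: "\<And>z. f (g z) = z"
  obtains A B where "A \<noteq> 0" "\<And>z. f z = A * z + B"
proof -
  have inj: "inj f" by (metis gf injI)
  have "compact {z. f z \<in> k}" if "compact k" for k
  proof -
    have "{z. f z \<in> k} = g ` k" by (auto simp: fg) (metis gf image_eqI)
    then show ?thesis
      using that assms(2) compact_continuous_image continuous_on_subset by (metis subset_UNIV)
  qed
  with hol obtain c n where f: "f = (\<lambda>z. \<Sum>i\<le>n. c i * z ^ i)" and n: "0 < n"
    using proper_map_polyfun_eq by metis
  define d where "d i = of_nat (Suc i) * c (Suc i)" for i
  obtain m where m: "n = Suc m" using n gr0_implies_Suc by blast
  have f': "f = (\<lambda>z. c 0 + (\<Sum>i\<le>m. c (Suc i) * z ^ Suc i))"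
    unfolding f m by (simp only: sum.atMost_Suc_shift power_0 mult_1_right)
  have "(f has_field_derivative (\<Sum>i\<le>m. d i * z ^ i)) (at z)" for z
    unfolding f' d_def by (auto intro!: derivative_eq_intros sum.cong simp del: power_Suc)
  then have "deriv f z = (\<Sum>i\<le>m. d i * z ^ i)" for z
    by (rule DERIV_imp_deriv)
  then have nz: "(\<Sum>i\<le>m. d i * z ^ i) \<noteq> 0" for z
    using holomorphic_injective_imp_regular [OF hol open_UNIV inj] by auto
  have dz: "d 0 \<noteq> 0 \<and> (\<forall>i\<in>{1..m}. d i = 0)"
    using fundamental_theorem_of_algebra [of d m] nz by metis
  have "c (Suc i) = 0" if "i \<in> {1..m}" for i
    using bspec [OF conjunct2 [OF dz] that] by (simp add: d_def del: of_nat_Suc)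
  then have "(\<Sum>i\<le>m. c (Suc i) * z ^ Suc i) = (\<Sum>i\<in>{0}. c (Suc i) * z ^ Suc i)" for z
    by (intro sum.mono_neutral_right) auto
  then have "f z = c 1 * z + c 0" for z
    unfolding f' by simp
  moreover have "c 1 \<noteq> 0" using dz by (simp add: d_def)
  ultimately show ?thesis using that by blast
qed

section \<open>Holomorphy in each coordinate and Liouville's theorem\<close>

lemma has_derivative_vector_fst:
  "((\<lambda>w. vector [w, z] :: complex^2) has_derivative (\<lambda>h. vector [h, 0])) (at w)"
proof -
  have "linear (\<lambda>h. vector [h, 0] :: complex^2)"
    by (intro linearI) (auto simp: vec_eq_iff forall_2)
  then have "((\<lambda>w. vector [w, 0] + vector [0, z] :: complex^2) has_derivative (\<lambda>h. vector [h, 0])) (at w)"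
    by (auto intro!: derivative_eq_intros bounded_linear_imp_has_derivative
        simp: linear_conv_bounded_linear)
  moreover have "(\<lambda>w. vector [w, z] :: complex^2) = (\<lambda>w. vector [w, 0] + vector [0, z])"
    by (auto simp: vec_eq_iff forall_2)
  ultimately show ?thesis by simp
qed

lemma has_derivative_vector_snd:
  "((\<lambda>z. vector [w, z] :: complex^2) has_derivative (\<lambda>h. vector [0, h])) (at z)"
proof -
  have "linear (\<lambda>h. vector [0, h] :: complex^2)"
    by (intro linearI) (auto simp: vec_eq_iff forall_2)
  then have "((\<lambda>z. vector [w, 0] + vector [0, z] :: complex^2) has_derivative (\<lambda>h. vector [0, h])) (at z)"
    by (auto intro!: derivative_eq_intros bounded_linear_imp_has_derivative
        simp: linear_conv_bounded_linear)
  moreover have "(\<lambda>z. vector [w, z] :: complex^2) = (\<lambda>z. vector [w, 0] + vector [0, z])"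
    by (auto simp: vec_eq_iff forall_2)
  ultimately show ?thesis by simp
qed

lemma complex_differentiable_at_partial:
  assumes "complex_differentiable_at f (vector [w, z])"
  shows "(\<lambda>w. f (vector [w, z]) $ i) field_differentiable (at w)"
    and "(\<lambda>z. f (vector [w, z]) $ i) field_differentiable (at z)"
proof -
  obtain J where J: "(f has_derivative (\<lambda>h. J *v h)) (at (vector [w, z]))"
    using assms by (auto simp: complex_differentiable_at_def)
  have "((\<lambda>w. f (vector [w, z]) $ i) has_derivative (\<lambda>h. (J *v vector [h, 0]) $ i)) (at w)"
    using has_derivative_compose [OF has_derivative_vector_fst J]
    by (rule bounded_linear.has_derivative [OF bounded_linear_vec_nth])
  then show "(\<lambda>w. f (vector [w, z]) $ i) field_differentiable (at w)"
    unfolding field_differentiable_def has_field_derivative_def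
    by (intro exI [of _ "J $ i $ 1"]) (simp add: matrix_vector_mult_def sum_2)
  have "((\<lambda>z. f (vector [w, z]) $ i) has_derivative (\<lambda>h. (J *v vector [0, h]) $ i)) (at z)"
    using has_derivative_compose [OF has_derivative_vector_snd J]
    by (rule bounded_linear.has_derivative [OF bounded_linear_vec_nth])
  then show "(\<lambda>z. f (vector [w, z]) $ i) field_differentiable (at z)"
    unfolding field_differentiable_def has_field_derivative_def
    by (intro exI [of _ "J $ i $ 2"]) (simp add: matrix_vector_mult_def sum_2)
qed

text \<open>The map 1/(u + \<i>) sends the half-plane into the unit disc, because |u + \<i>| \<ge>
  Im u + 1; Liouville's theorem applies to the composite.\<close>

lemma entire_into_halfplane_constant:
  assumes hol: "f holomorphic_on UNIV" and Im: "\<And>z. 0 < Im (f z)"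
  shows "f z = f 0"
proof -
  have nz: "f z + \<i> \<noteq> 0" for z
    using Im [of z] by (auto simp: complex_eq_iff)
  have "(\<lambda>z. 1 / (f z + \<i>)) holomorphic_on UNIV"
    using hol nz by (intro holomorphic_intros) auto
  moreover have "bounded (range (\<lambda>z. 1 / (f z + \<i>)))"
  proof (rule boundedI)
    fix x assume "x \<in> range (\<lambda>z. 1 / (f z + \<i>))"
    then obtain z where x: "x = 1 / (f z + \<i>)" by auto
    have "1 \<le> \<bar>Im (f z + \<i>)\<bar>" using Im [of z] by simp
    also have "\<dots> \<le> norm (f z + \<i>)" by (rule abs_Im_le_cmod)
    finally show "norm x \<le> 1" by (simp add: x norm_divide divide_simps)
  qed
  ultimately obtain c where "\<And>z. 1 / (f z + \<i>) = c"
    using Liouville_theorem by (metis UNIV_I constant_on_def)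
  then have "1 / (f z + \<i>) = 1 / (f 0 + \<i>)" by simp
  then show ?thesis using nz [of z] nz [of 0] by (simp add: field_simps)
qed

text \<open>Each fibre {w} x C is a copy of C, so the first coordinate is constant on it, for \<Psi>
  as well as for \<Phi>. Hence \<Phi> carries the fibre over w bijectively to the one over
  \<phi>(w), with inverse given by \<Psi>, and an entire homeomorphism is affine.\<close>

lemma automorphism_fibred:
  fixes \<Phi> \<Psi> :: "complex^2 \<Rightarrow> complex^2"
  assumes \<Phi>: "\<And>p. p \<in> UU \<Longrightarrow> \<Phi> p \<in> UU" "\<And>p. p \<in> UU \<Longrightarrow> complex_differentiable_at \<Phi> p"
    and \<Psi>: "\<And>p. p \<in> UU \<Longrightarrow> \<Psi> p \<in> UU" "\<And>p. p \<in> UU \<Longrightarrow> complex_differentiable_at \<Psi> p"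
    and inv: "\<And>p. p \<in> UU \<Longrightarrow> \<Psi> (\<Phi> p) = p" "\<And>p. p \<in> UU \<Longrightarrow> \<Phi> (\<Psi> p) = p"
  obtains \<phi> A B where "\<phi> holomorphic_on {w. 0 < Im w}" "A holomorphic_on {w. 0 < Im w}"
    "B holomorphic_on {w. 0 < Im w}" "inj_on \<phi> {w. 0 < Im w}"
    "\<And>w. 0 < Im w \<Longrightarrow> A w \<noteq> 0"
    "\<And>w z. 0 < Im w \<Longrightarrow> \<Phi> (vector [w, z]) = vector [\<phi> w, A w * z + B w]"
proof -
  have fst_const: "F (vector [w, z]) $ 1 = F (vector [w, 0]) $ 1"
    if F: "\<And>p. p \<in> UU \<Longrightarrow> F p \<in> UU" "\<And>p. p \<in> UU \<Longrightarrow> complex_differentiable_at F p"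
      and w: "0 < Im w" for F w z
  proof (rule entire_into_halfplane_constant)
    show "(\<lambda>z. F (vector [w, z]) $ 1) holomorphic_on UNIV"
      unfolding holomorphic_on_def using F(2) w
      by (auto intro!: complex_differentiable_at_partial(2))
    show "0 < Im (F (vector [w, z]) $ 1)" for z
      using F(1) [of "vector [w, z]"] w by simp
  qed
  define \<phi> where "\<phi> w = \<Phi> (vector [w, 0]) $ 1" for w
  define \<psi> where "\<psi> w = \<Psi> (vector [w, 0]) $ 1" for w
  \<comment> \<open>Intercept and slope in z are read off at z = 0 and z = 1, which makes their
    holomorphy in w immediate.\<close>
  define B where "B w = \<Phi> (vector [w, 0]) $ 2" for w
  define A where "A w = \<Phi> (vector [w, 1]) $ 2 - B w" for w
  have hol: "(\<lambda>w. \<Phi> (vector [w, z]) $ i) holomorphic_on {w. 0 < Im w}" for z i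
    unfolding holomorphic_on_def using \<Phi>(2)
    by (auto intro: field_differentiable_at_within [OF complex_differentiable_at_partial(1)])
  have \<Phi>1: "\<Phi> (vector [w, z]) $ 1 = \<phi> w" if "0 < Im w" for w z
    unfolding \<phi>_def using fst_const [OF \<Phi> that] by simp
  have \<Psi>1: "\<Psi> (vector [w, z]) $ 1 = \<psi> w" if "0 < Im w" for w z
    unfolding \<psi>_def using fst_const [OF \<Psi> that] by simp
  have Im_\<phi>: "0 < Im (\<phi> w)" if "0 < Im w" for w
    using \<Phi>(1) [of "vector [w, 0]"] that by (simp add: \<phi>_def)
  have \<psi>\<phi>: "\<psi> (\<phi> w) = w" if "0 < Im w" for w
    using inv(1) [of "vector [w, 0]"] \<Psi>1 [OF Im_\<phi> [OF that], of "\<Phi> (vector [w, 0]) $ 2"] that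
      \<Phi>1 [OF that, of 0]
    by (metis UU_iff vector_2(1) vector_2_eta)
  have affine: "A w \<noteq> 0 \<and> (\<forall>z. \<Phi> (vector [w, z]) $ 2 = A w * z + B w)" if w: "0 < Im w" for w
  proof -
    \<comment> \<open>\<Phi> on the fibre over w and \<Psi> on the fibre over \<phi>(w), as
      functions of z.\<close>
    define f where "f z = \<Phi> (vector [w, z]) $ 2" for z
    define g where "g z = \<Psi> (vector [\<phi> w, z]) $ 2" for z
    have f: "\<Phi> (vector [w, z]) = vector [\<phi> w, f z]" for z
      using \<Phi>1 [OF w, of z] by (simp add: f_def vec_eq_iff forall_2)
    have g: "\<Psi> (vector [\<phi> w, z]) = vector [w, g z]" for z
      using \<Psi>1 [OF Im_\<phi> [OF w], of z] \<psi>\<phi> [OF w] by (simp add: g_def vec_eq_iff forall_2)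
    have f_hol: "f holomorphic_on UNIV"
      unfolding holomorphic_on_def f_def using \<Phi>(2) w
      by (auto intro!: complex_differentiable_at_partial(2))
    have "g holomorphic_on UNIV"
      unfolding holomorphic_on_def g_def using \<Psi>(2) Im_\<phi> [OF w]
      by (auto intro!: complex_differentiable_at_partial(2))
    then have "continuous_on UNIV g" by (rule holomorphic_on_imp_continuous_on)
    moreover have "g (f z) = z" for z
      using inv(1) [of "vector [w, z]"] w by (simp add: f g)
    moreover have "f (g z) = z" for z
      using inv(2) [of "vector [\<phi> w, z]"] Im_\<phi> [OF w] by (simp add: f g)
    ultimately obtain A0 B0 where "A0 \<noteq> 0" "\<And>z. f z = A0 * z + B0"
      using entire_homeomorphism_affine [OF f_hol] by metis
    then show ?thesis by (simp add: A_def B_def flip: f_def)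
  qed
  show thesis
  proof (rule that)
    show "\<phi> holomorphic_on {w. 0 < Im w}" unfolding \<phi>_def by (rule hol)
    show "A holomorphic_on {w. 0 < Im w}" unfolding A_def B_def by (intro holomorphic_intros hol)
    show "B holomorphic_on {w. 0 < Im w}" unfolding B_def by (rule hol)
    show "inj_on \<phi> {w. 0 < Im w}" by (metis \<psi>\<phi> inj_onI mem_Collect_eq)
    show "A w \<noteq> 0" if "0 < Im w" for w using affine [OF that] by simp
    show "\<Phi> (vector [w, z]) = vector [\<phi> w, A w * z + B w]" if "0 < Im w" for w z
      using affine [OF that] \<Phi>1 [OF that] by (simp add: vec_eq_iff forall_2)
  qed
qed

section \<open>Functional equations and their derivatives\<close>

lemma deriv_affine_relation:
  fixes l a :: real
  assumes hol: "f holomorphic_on {w. 0 < Im w}" and "0 < l"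
    and eq: "\<And>w. 0 < Im w \<Longrightarrow> f (of_real l * w + of_real a) = c * f w + u * w + v"
    and w: "0 < Im w"
  shows "of_real l * deriv f (of_real l * w + of_real a) = c * deriv f w + u"
proof -
  have f': "(f has_field_derivative deriv f w) (at w)" if "0 < Im w" for w
    using holomorphic_derivI [OF hol open_halfplane] that by simp
  have "((\<lambda>w. f (of_real l * w + of_real a)) has_field_derivative
      deriv f (of_real l * w + of_real a) * of_real l) (at w)"
    using f' [of "of_real l * w + of_real a"] w \<open>0 < l\<close>
    by (intro DERIV_chain2 [of f]) (auto intro!: derivative_eq_intros)
  moreover have "((\<lambda>w. c * f w + u * w + v) has_field_derivative (c * deriv f w + u)) (at w)"
    using f' [OF w] by (auto intro!: derivative_eq_intros)
  then have "((\<lambda>w. f (of_real l * w + of_real a)) has_field_derivative (c * deriv f w + u)) (at w)"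
    by (rule has_field_derivative_transform_within_open [OF _ open_halfplane]) (use w eq in auto)
  ultimately show ?thesis
    using DERIV_unique by (metis mult.commute)
qed

lemma halfplane_deriv_zero:
  assumes hol: "f holomorphic_on {w. 0 < Im w}" and "\<And>w. 0 < Im w \<Longrightarrow> deriv f w = 0"
  obtains c where "\<And>w. 0 < Im w \<Longrightarrow> f w = c"
proof -
  have "(f has_field_derivative 0) (at w within {w. 0 < Im w})" if "0 < Im w" for w
    using holomorphic_derivI [OF hol open_halfplane] assms(2) that by fastforce
  then show ?thesis
    using has_field_derivative_zero_constant [OF convex_halfplane, of f] that by (metis mem_Collect_eq)
qed

lemma halfplane_deriv2_zero:
  assumes hol: "f holomorphic_on {w. 0 < Im w}" and "\<And>w. 0 < Im w \<Longrightarrow> deriv (deriv f) w = 0"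
  obtains u v where "\<And>w. 0 < Im w \<Longrightarrow> f w = u * w + v"
proof -
  obtain u where u: "\<And>w. 0 < Im w \<Longrightarrow> deriv f w = u"
    using halfplane_deriv_zero [OF holomorphic_deriv [OF hol open_halfplane] assms(2)] by metis
  have "(\<lambda>w. f w - u * w) holomorphic_on {w. 0 < Im w}"
    by (intro holomorphic_intros hol)
  moreover have "deriv (\<lambda>w. f w - u * w) w = 0" if "0 < Im w" for w
  proof (rule DERIV_imp_deriv)
    show "((\<lambda>w. f w - u * w) has_field_derivative 0) (at w)"
      using holomorphic_derivI [OF hol open_halfplane, of w] u [OF that] that
      by (auto intro!: derivative_eq_intros)
  qed
  ultimately obtain v where v: "\<And>w. 0 < Im w \<Longrightarrow> f w - u * w = v"
    using halfplane_deriv_zero [of "\<lambda>w. f w - u * w"] by auto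
  have "f w = u * w + v" if "0 < Im w" for w
    using v [OF that] by (simp add: algebra_simps)
  then show ?thesis using that by blast
qed

lemma equivariant_fibred_affine:
  fixes \<Phi> :: "complex^2 \<Rightarrow> complex^2" and a m :: real
  assumes hol: "\<phi> holomorphic_on {w. 0 < Im w}" "A holomorphic_on {w. 0 < Im w}"
      "B holomorphic_on {w. 0 < Im w}"
    and inj: "inj_on \<phi> {w. 0 < Im w}" and A: "\<And>w. 0 < Im w \<Longrightarrow> A w \<noteq> 0"
    and \<Phi>: "\<And>w z. 0 < Im w \<Longrightarrow> \<Phi> (vector [w, z]) = vector [\<phi> w, A w * z + B w]"
    and par: "a \<noteq> 0" "m > 1" "\<kappa> \<noteq> 0" "\<kappa> \<noteq> of_real (m\<^sup>2)"
      "l \<noteq> 0" "k \<noteq> 0" "l' \<noteq> 0" "k' \<noteq> 0"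
    and trans: "\<And>w z. 0 < Im w \<Longrightarrow> \<Phi> (vector [w + of_real a, z + y * w + s]) =
      (let q = \<Phi> (vector [w, z]) in vector [l * q$1 + x, k * q$2 + n * q$1 + r])"
    and scale: "\<And>w z. 0 < Im w \<Longrightarrow> \<Phi> (vector [of_real m * w, \<kappa> * z + t]) =
      (let q = \<Phi> (vector [w, z]) in vector [l' * q$1 + x', k' * q$2 + n' * q$1 + r'])"
  obtains u v A0 e f where "u \<noteq> 0" "A0 \<noteq> 0"
    "\<And>p. p \<in> UU \<Longrightarrow> \<Phi> p = vector [u * p$1 + v, A0 * p$2 + e * p$1 + f]"
proof -
  have tr1: "\<phi> (w + of_real a) = l * \<phi> w + x"
    and tr2: "A (w + of_real a) * (z + y * w + s) + B (w + of_real a) =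
      k * (A w * z + B w) + n * \<phi> w + r" if "0 < Im w" for w z
    using trans [OF that, of z] \<Phi> [of "w + of_real a" "z + y * w + s"] \<Phi> [of w z] that
    by (simp_all add: Let_def)
  have sc1: "\<phi> (of_real m * w) = l' * \<phi> w + x'"
    and sc2: "A (of_real m * w) * (\<kappa> * z + t) + B (of_real m * w) =
      k' * (A w * z + B w) + n' * \<phi> w + r'" if "0 < Im w" for w z
    using scale [OF that, of z] \<Phi> [of "of_real m * w" "\<kappa> * z + t"] \<Phi> [of w z] that par
    by (simp_all add: Let_def)
  \<comment> \<open>Both sides are affine in z; the values at z = 0 and z = 1 isolate the
    coefficient of z.\<close>
  have trA: "A (w + of_real a) = k * A w" if "0 < Im w" for w
    using tr2 [OF that, of 0] tr2 [OF that, of 1] by (simp add: algebra_simps)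
  have scA: "\<kappa> * A (of_real m * w) = k' * A w" if "0 < Im w" for w
    using arg_cong2 [OF sc2 [OF that, of 1] sc2 [OF that, of 0], of "(-)"] by (simp add: algebra_simps)

  \<comment> \<open>Each use of \<open>D\<close> removes one layer of the inhomogeneity: the first
    derivative loses the constant, the second also the linear term.\<close>
  note D = deriv_affine_relation and hd = holomorphic_deriv [OF _ open_halfplane]
  have \<phi>'_nz: "deriv \<phi> w \<noteq> 0" if "0 < Im w" for w
    using holomorphic_injective_imp_regular [OF hol(1) open_halfplane inj] that by simp
  have tr\<phi>': "deriv \<phi> (w + of_real a) = l * deriv \<phi> w" if "0 < Im w" for w
    using D [OF hol(1), of 1 a l 0 x w] tr1 that by simp
  have sc\<phi>': "of_real m * deriv \<phi> (of_real m * w) = l' * deriv \<phi> w" if "0 < Im w" for w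
    using D [OF hol(1), of m 0 l' 0 x' w] sc1 that par by simp
  have tr\<phi>'': "deriv (deriv \<phi>) (w + of_real a) = l * deriv (deriv \<phi>) w" if "0 < Im w" for w
    using D [OF hd [OF hol(1)], of 1 a l 0 0 w] tr\<phi>' that by simp
  have sc\<phi>'': "of_real m * deriv (deriv \<phi>) (of_real m * w) = l' / of_real m * deriv (deriv \<phi>) w"
    if "0 < Im w" for w
    using D [OF hd [OF hol(1)], of m 0 "l' / of_real m" 0 0 w] sc\<phi>' that par
    by (simp add: field_simps)
  \<comment> \<open>The denominator has no zeros because \<phi> is injective; under w -> m w the
    numerator gains one factor 1 / m more than the denominator.\<close>
  have "deriv (deriv \<phi>) w / deriv \<phi> w = 0" if "0 < Im w" for w
  proof (rule quasi_periodic_zero [of "\<lambda>w. deriv (deriv \<phi>) w / deriv \<phi> w" a m "1 / of_real m"])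
    show "(\<lambda>w. deriv (deriv \<phi>) w / deriv \<phi> w) holomorphic_on {w. 0 < Im w}"
      using \<phi>'_nz by (intro holomorphic_intros hd hol) auto
    fix w assume w: "0 < Im w"
    show "deriv (deriv \<phi>) (w + of_real a) / deriv \<phi> (w + of_real a) = deriv (deriv \<phi>) w / deriv \<phi> w"
      using tr\<phi>' [OF w] tr\<phi>'' [OF w] par by simp
    have w': "0 < Im (of_real m * w)" using w par by simp
    show "deriv (deriv \<phi>) (of_real m * w) / deriv \<phi> (of_real m * w) =
        1 / of_real m * (deriv (deriv \<phi>) w / deriv \<phi> w)"
    proof -
      have "deriv \<phi> (of_real m * w) = l' / of_real m * deriv \<phi> w"
        using sc\<phi>' [OF w] par by (simp add: field_simps)
      moreover have "deriv (deriv \<phi>) (of_real m * w) = l' / of_real m / of_real m * deriv (deriv \<phi>) w"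
        using sc\<phi>'' [OF w] par by (simp add: field_simps)
      ultimately show ?thesis using par by simp
    qed
  qed (use par that in auto)
  then have "deriv (deriv \<phi>) w = 0" if "0 < Im w" for w
    using \<phi>'_nz that by (metis divide_eq_0_iff)
  then obtain u v where uv: "\<And>w. 0 < Im w \<Longrightarrow> \<phi> w = u * w + v"
    using halfplane_deriv2_zero [OF hol(1)] by metis
  have "u \<noteq> 0"
  proof
    assume "u = 0"
    then have "\<phi> \<i> = \<phi> (2 * \<i>)" by (simp add: uv)
    then show False using inj_onD [OF inj] by force
  qed

  have trA': "deriv A (w + of_real a) = k * deriv A w" if "0 < Im w" for w
    using D [OF hol(2), of 1 a k 0 0 w] trA that by simp
  have scA': "of_real m * deriv A (of_real m * w) = k' / \<kappa> * deriv A w" if "0 < Im w" for w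
    using D [OF hol(2), of m 0 "k' / \<kappa>" 0 0 w] scA that par by (simp add: field_simps)
  have "deriv A w / A w = 0" if "0 < Im w" for w
  proof (rule quasi_periodic_zero [of "\<lambda>w. deriv A w / A w" a m "1 / of_real m"])
    show "(\<lambda>w. deriv A w / A w) holomorphic_on {w. 0 < Im w}"
      using A by (intro holomorphic_intros hd hol) auto
    fix w assume w: "0 < Im w"
    show "deriv A (w + of_real a) / A (w + of_real a) = deriv A w / A w"
      using trA [OF w] trA' [OF w] par by simp
    have "A (of_real m * w) = k' / \<kappa> * A w"
      using scA [OF w] par by (simp add: field_simps)
    moreover have "deriv A (of_real m * w) = k' / \<kappa> / of_real m * deriv A w"
      using scA' [OF w] par by (simp add: field_simps)
    ultimately show "deriv A (of_real m * w) / A (of_real m * w) = 1 / of_real m * (deriv A w / A w)"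
      using par by simp
  qed (use par that in auto)
  then have "deriv A w = 0" if "0 < Im w" for w
    using A that by (metis divide_eq_0_iff)
  then obtain A0 where A0: "\<And>w. 0 < Im w \<Longrightarrow> A w = A0"
    using halfplane_deriv_zero [OF hol(2)] by metis
  have "A0 \<noteq> 0" using A [of \<i>] A0 [of \<i>] by simp
  \<comment> \<open>A nonzero constant \<open>A\<close> satisfies the two functional equations only
    with these multipliers.\<close>
  have "k = 1"
    using trA [of \<i>] A0 [of \<i>] A0 [of "\<i> + of_real a"] \<open>A0 \<noteq> 0\<close> by simp
  have "k' = \<kappa>"
    using scA [of \<i>] A0 [of \<i>] A0 [of "of_real m * \<i>"] \<open>A0 \<noteq> 0\<close> par by simp

  \<comment> \<open>Since \<phi> is affine, the terms \<open>n * \<phi> w\<close> and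
    \<open>n' * \<phi> w\<close> only contribute affine functions of w, which disappear from the
    second derivative.\<close>
  have trB: "B (w + of_real a) = B w + (n * u - A0 * y) * w + (n * v + r - A0 * s)" if "0 < Im w" for w
    using tr2 [OF that, of 0] A0 [of w] A0 [of "w + of_real a"] that \<open>k = 1\<close> uv [OF that]
    by (simp add: algebra_simps)
  have scB: "B (of_real m * w) = \<kappa> * B w + (n' * u) * w + (n' * v + r' - A0 * t)" if "0 < Im w" for w
    using sc2 [OF that, of 0] A0 [of w] A0 [of "of_real m * w"] that \<open>k' = \<kappa>\<close> uv [OF that] par
    by (simp add: algebra_simps)
  have trB': "deriv B (w + of_real a) = deriv B w + (n * u - A0 * y)" if "0 < Im w" for w
    using D [OF hol(3), of 1 a 1 "n * u - A0 * y" "n * v + r - A0 * s" w] trB that by simp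
  have scB': "of_real m * deriv B (of_real m * w) = \<kappa> * deriv B w + n' * u" if "0 < Im w" for w
    using D [OF hol(3), of m 0 \<kappa> "n' * u" "n' * v + r' - A0 * t" w] scB that par by simp
  have trB'': "deriv (deriv B) (w + of_real a) = deriv (deriv B) w" if "0 < Im w" for w
    using D [OF hd [OF hol(3)], of 1 a 1 0 "n * u - A0 * y" w] trB' that by simp
  have scB'': "of_real m * deriv (deriv B) (of_real m * w) = \<kappa> / of_real m * deriv (deriv B) w"
    if "0 < Im w" for w
    using D [OF hd [OF hol(3)], of m 0 "\<kappa> / of_real m" 0 "n' * u / of_real m" w] scB' that par
    by (simp add: field_simps)
  have "deriv (deriv B) w = 0" if "0 < Im w" for w
  proof (rule quasi_periodic_zero [of "deriv (deriv B)" a m "\<kappa> / of_real (m\<^sup>2)"])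
    show "deriv (deriv B) holomorphic_on {w. 0 < Im w}"
      by (intro hd hol)
    show "\<kappa> / of_real (m\<^sup>2) \<noteq> 1" using par by (simp add: field_simps)
    show "deriv (deriv B) (of_real m * w) = \<kappa> / of_real (m\<^sup>2) * deriv (deriv B) w" if "0 < Im w" for w
      using scB'' [OF that] par by (simp add: field_simps power2_eq_square)
  qed (use par that trB'' in auto)
  then obtain e f where ef: "\<And>w. 0 < Im w \<Longrightarrow> B w = e * w + f"
    using halfplane_deriv2_zero [OF hol(3)] by metis
  show thesis
  proof (rule that [OF \<open>u \<noteq> 0\<close> \<open>A0 \<noteq> 0\<close>])
    fix p assume "p \<in> UU"
    then show "\<Phi> p = vector [u * p$1 + v, A0 * p$2 + e * p$1 + f]"
      using \<Phi> [of "p$1" "p$2"] uv [of "p$1"] ef [of "p$1"] A0 [of "p$1"]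
      by (simp add: vector_2_eta)
  qed
qed

section \<open>Affine maps and quotients\<close>

text \<open>The prefix syntax of the library parses inv f p as inv (f p).\<close>

abbreviation inv_AffU where "inv_AffU \<equiv> m_inv AffU"

lemma carrier_AffU_D:
  assumes "g \<in> carrier AffU"
  shows "g ` UU = UU" "continuous_on S g" "complex_differentiable_at g p"
    "inv_AffU g \<in> carrier AffU" "inv_AffU g (g p) = p" "g (inv_AffU g p) = p"
proof -
  interpret group AffU by (rule group_AffU)
  show "g ` UU = UU" using assms by (simp add: AffU_def)
  obtain M v where g: "g = (\<lambda>p. M *v p + v)" using assms by (auto simp: AffU_def)
  have "linear (\<lambda>p. M *v p)"
  proof (rule linearI)
    show "M *v (r *\<^sub>R p) = r *\<^sub>R (M *v p)" for r p
      by (simp add: matrix_vector_mult_def vec_eq_iff scaleR_sum_right)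
  qed (rule matrix_vector_right_distrib)
  then have "bounded_linear (\<lambda>p. M *v p)" by (simp add: linear_conv_bounded_linear)
  then have d: "(g has_derivative (\<lambda>h. M *v h)) (at p)" for p
    unfolding g by (auto intro!: derivative_eq_intros bounded_linear_imp_has_derivative)
  then show "complex_differentiable_at g p" by (auto simp: complex_differentiable_at_def)
  show "continuous_on S g"
    by (auto intro!: continuous_at_imp_continuous_on has_derivative_continuous [OF d])
  show "inv_AffU g \<in> carrier AffU" using assms by simp
  show "inv_AffU g (g p) = p" "g (inv_AffU g p) = p"
    using l_inv [OF assms] r_inv [OF assms] by (simp_all add: AffU_def fun_eq_iff)
qed

lemma open_image_AffU:
  assumes "g \<in> carrier AffU" "open W"
  shows "open (g ` W)"
proof -
  have "g ` W = inv_AffU g -` W"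
    using carrier_AffU_D(5,6) [OF assms(1)] by (auto simp: image_iff) metis
  then show ?thesis
    using open_vimage [OF assms(2) carrier_AffU_D(2) [OF carrier_AffU_D(4) [OF assms(1)]]] by simp
qed

text \<open>Identities between group elements are obtained on \<open>UU\<close>, whereas members of
  \<open>AffU\<close> are maps of C^2. An affine map is determined by its values at the points
  (\<i>, 0), (2\<i>, 0), (\<i>, 1) of \<open>UU\<close>.\<close>

lemma AffU_eq_if_eq_on_UU:
  assumes "f \<in> carrier AffU" "g \<in> carrier AffU" and eq: "\<And>p. p \<in> UU \<Longrightarrow> f p = g p"
  shows "f = g"
proof -
  obtain M v where f: "f = (\<lambda>p. M *v p + v)" using assms by (auto simp: AffU_def)
  obtain N w where g: "g = (\<lambda>p. N *v p + w)" using assms by (auto simp: AffU_def)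
  have "M$i$1 * x + M$i$2 * y + v$i = N$i$1 * x + N$i$2 * y + w$i" if "0 < Im x" for i x y
    using arg_cong [OF eq [of "vector [x, y]"], of "\<lambda>q. q$i"] that
    by (simp add: f g matrix_vector_mult_def sum_2)
  from this [of \<i> _ 0] this [of "2 * \<i>" _ 0] this [of \<i> _ 1]
  have e: "M$i$1 * \<i> + v$i = N$i$1 * \<i> + w$i" "M$i$1 * (2 * \<i>) + v$i = N$i$1 * (2 * \<i>) + w$i"
    "M$i$1 * \<i> + M$i$2 + v$i = N$i$1 * \<i> + N$i$2 + w$i" for i
    by simp_all
  have "M$i$1 * \<i> = N$i$1 * \<i>" for i
    using arg_cong2 [OF e(2) [of i] e(1) [of i], of "(-)"] by (simp add: algebra_simps)
  then have 1: "M$i$1 = N$i$1" for i by simp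
  with e(1) have "v$i = w$i" for i by simp
  moreover with 1 e(3) have "M$i$2 = N$i$2" for i by simp
  ultimately have "M = N" "v = w" using 1 by (simp_all add: vec_eq_iff forall_2)
  then show ?thesis by (simp add: f g)
qed

text \<open>If the entry \<open>M$1$2\<close> were nonzero, the first coordinate on the line w =
  \<i> would be a nonconstant affine function of z and would take the value 0, which lies outside
  the half-plane.\<close>

lemma AffU_triangular:
  assumes "g \<in> carrier AffU"
  obtains l x k n r where "l \<noteq> 0" "k \<noteq> 0"
    "\<And>p. g p = vector [l * p$1 + x, k * p$2 + n * p$1 + r]"
proof -
  obtain M v where M: "invertible M" and g: "g = (\<lambda>p. M *v p + v)"
    using assms by (auto simp: AffU_def)
  have im: "0 < Im (M$1$1 * \<i> + M$1$2 * z + v$1)" for z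
  proof -
    have "g (vector [\<i>, z]) \<in> UU"
      using carrier_AffU_D(1) [OF assms] by (metis UU_iff imageI imaginary_unit.sel(2) vector_2(1) zero_less_one)
    then show ?thesis by (simp add: g matrix_vector_mult_def sum_2)
  qed
  have M12: "M$1$2 = 0"
  proof (rule ccontr)
    assume "M$1$2 \<noteq> 0"
    then show False using im [of "(- M$1$1 * \<i> - v$1) / M$1$2"] by simp
  qed
  have "M$1$1 \<noteq> 0" "M$2$2 \<noteq> 0"
    using M M12 by (auto simp: invertible_det_nz det_2)
  then show ?thesis
    using M12 by (intro that [of "M$1$1" "M$2$2" "v$1" "M$2$1" "v$2"])
      (auto simp: g matrix_vector_mult_def sum_2 vec_eq_iff forall_2)
qed

lemma UU_eq_vimage: "UU = (\<lambda>p. p $ 1) -` {w. 0 < Im w}"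
  by auto

lemma convex_UU: "convex UU"
  unfolding UU_eq_vimage
  by (intro convex_linear_vimage convex_halfplane bounded_linear.linear bounded_linear_vec_nth)

lemma open_UU: "open UU"
  unfolding UU_eq_vimage
  by (intro open_vimage open_halfplane continuous_on_component continuous_on_id)

section \<open>Orbits and the quotient topology\<close>

locale AffU_subgroup =
  fixes \<Gamma> :: "(complex^2 \<Rightarrow> complex^2) set"
  assumes subgroup: "subgroup \<Gamma> AffU"
begin

lemma in_carrier: "g \<in> \<Gamma> \<Longrightarrow> g \<in> carrier AffU"
  using subgroup by (auto dest: subgroup.subset)

lemma id_mem: "id \<in> \<Gamma>"
  using subgroup.one_closed [OF subgroup] by (simp add: AffU_def)

lemma comp_mem: "g \<in> \<Gamma> \<Longrightarrow> h \<in> \<Gamma> \<Longrightarrow> g \<circ> h \<in> \<Gamma>"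
  using subgroup.m_closed [OF subgroup, of g h] by (simp add: AffU_def)

lemma inv_mem: "g \<in> \<Gamma> \<Longrightarrow> inv_AffU g \<in> \<Gamma>"
  using subgroup.m_inv_closed [OF subgroup] .

lemmas inv_apply = carrier_AffU_D(5,6) [OF in_carrier]

lemma maps_UU: "g \<in> \<Gamma> \<Longrightarrow> p \<in> UU \<Longrightarrow> g p \<in> UU"
  using carrier_AffU_D(1) [OF in_carrier] by blast

lemma orbit_proj_eq_iff: "orbit_proj \<Gamma> p = orbit_proj \<Gamma> q \<longleftrightarrow> (\<exists>g\<in>\<Gamma>. q = g p)"
proof
  assume "orbit_proj \<Gamma> p = orbit_proj \<Gamma> q"
  moreover have "q \<in> orbit_proj \<Gamma> q" 
    unfolding orbit_proj_def using id_mem by (auto intro!: exI [of _ id])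
  ultimately show "\<exists>g\<in>\<Gamma>. q = g p" by (auto simp: orbit_proj_def)
next
  assume "\<exists>g\<in>\<Gamma>. q = g p"
  then obtain g where g: "g \<in> \<Gamma>" "q = g p" by blast
  have "h p = (h \<circ> inv_AffU g) q" for h by (simp add: g inv_apply)
  moreover have "h q = (h \<circ> g) p" for h by (simp add: g)
  ultimately show "orbit_proj \<Gamma> p = orbit_proj \<Gamma> q"
    unfolding orbit_proj_def using comp_mem g inv_mem by blast
qed

lemma orbit_proj_apply [simp]: "g \<in> \<Gamma> \<Longrightarrow> orbit_proj \<Gamma> (g p) = orbit_proj \<Gamma> p"
  using orbit_proj_eq_iff by metis

lemma topspace_quotient [simp]: "topspace (quotient_topology \<Gamma>) = orbit_proj \<Gamma> ` UU"
proof -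
  have "{p \<in> UU. orbit_proj \<Gamma> p \<in> orbit_proj \<Gamma> ` UU} = UU" by blast
  then have "openin (quotient_topology \<Gamma>) (orbit_proj \<Gamma> ` UU)"
    by (simp add: openin_quotient_topology open_UU)
  then show ?thesis
    by (metis openin_quotient_topology openin_subset openin_topspace subset_antisym)
qed

text \<open>The saturation of \<open>W\<close> is the union of its translates, each of which is
  open; so the projection is an open map.\<close>

lemma openin_orbit_proj_image:
  assumes "open W" "W \<subseteq> UU"
  shows "openin (quotient_topology \<Gamma>) (orbit_proj \<Gamma> ` W)"
proof -
  have "{p \<in> UU. orbit_proj \<Gamma> p \<in> orbit_proj \<Gamma> ` W} = (\<Union>g\<in>\<Gamma>. g ` W)"
  proof (intro equalityI subsetI)
    fix p assume "p \<in> {p \<in> UU. orbit_proj \<Gamma> p \<in> orbit_proj \<Gamma> ` W}"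
    then obtain q where "q \<in> W" "orbit_proj \<Gamma> q = orbit_proj \<Gamma> p" by force
    then show "p \<in> (\<Union>g\<in>\<Gamma>. g ` W)" using orbit_proj_eq_iff by blast
  next
    fix p assume "p \<in> (\<Union>g\<in>\<Gamma>. g ` W)"
    then obtain g q where "g \<in> \<Gamma>" "q \<in> W" "p = g q" by blast
    then show "p \<in> {p \<in> UU. orbit_proj \<Gamma> p \<in> orbit_proj \<Gamma> ` W}"
      using assms(2) maps_UU [of g q] by auto
  qed
  moreover have "open (\<Union>g\<in>\<Gamma>. g ` W)"
    using assms(1) open_image_AffU in_carrier by blast
  ultimately show ?thesis
    using assms(2) by (auto simp: openin_quotient_topology)
qed

lemma continuous_map_orbit_proj:
  "continuous_map (top_of_set UU) (quotient_topology \<Gamma>) (orbit_proj \<Gamma>)"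
  unfolding continuous_map_def
  by (auto simp: openin_quotient_topology openin_open_eq [OF open_UU] topspace_quotient)

text \<open>The universal property of the quotient topology.\<close>

lemma continuous_map_from_quotient:
  assumes "continuous_map (top_of_set UU) X (f \<circ> orbit_proj \<Gamma>)"
  shows "continuous_map (quotient_topology \<Gamma>) X f"
  unfolding continuous_map_def
proof (intro conjI allI impI)
  show "f \<in> topspace (quotient_topology \<Gamma>) \<rightarrow> topspace X"
    using assms by (auto simp: continuous_map_def)
  fix T assume "openin X T"
  then have "openin (top_of_set UU) {p \<in> UU. f (orbit_proj \<Gamma> p) \<in> T}"
    using assms by (auto simp: continuous_map_def)
  moreover have "{p \<in> UU. orbit_proj \<Gamma> p \<in> {x \<in> topspace (quotient_topology \<Gamma>). f x \<in> T}} =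
      {p \<in> UU. f (orbit_proj \<Gamma> p) \<in> T}"
    by auto
  ultimately show "openin (quotient_topology \<Gamma>) {x \<in> topspace (quotient_topology \<Gamma>). f x \<in> T}"
    unfolding openin_quotient_topology by (auto simp: openin_open_eq [OF open_UU])
qed

end

section \<open>Maps between quotients in charts\<close>

lemma complex_differentiable_at_transform:
  assumes "complex_differentiable_at f p" "open S" "p \<in> S" "\<And>q. q \<in> S \<Longrightarrow> f q = g q"
  shows "complex_differentiable_at g p"
proof -
  obtain J where "(f has_derivative (\<lambda>h. J *v h)) (at p)"
    using assms(1) by (auto simp: complex_differentiable_at_def)
  then have "(g has_derivative (\<lambda>h. J *v h)) (at p)"
    using assms(2-4) by (rule has_derivative_transform_within_open)
  then show ?thesis by (auto simp: complex_differentiable_at_def)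
qed

lemma holomorphic_map_quotient_iff:
  "holomorphic_map (quotient_surface \<Gamma>') (quotient_surface \<Gamma>'') F \<longleftrightarrow>
     continuous_map (quotient_topology \<Gamma>') (quotient_topology \<Gamma>'') F \<and>
     (\<forall>W' W'' x. open W' \<and> W' \<subseteq> UU \<and> inj_on (orbit_proj \<Gamma>') W' \<and>
        open W'' \<and> W'' \<subseteq> UU \<and> inj_on (orbit_proj \<Gamma>'') W'' \<and>
        x \<in> orbit_proj \<Gamma>' ` W' \<and> F x \<in> orbit_proj \<Gamma>'' ` W'' \<longrightarrow>
        complex_differentiable_at (inv_into W'' (orbit_proj \<Gamma>'') \<circ> F \<circ>
            inv_into (orbit_proj \<Gamma>' ` W') (inv_into W' (orbit_proj \<Gamma>')))
          (inv_into W' (orbit_proj \<Gamma>') x))"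
proof -
  have atlas: "(\<forall>(V, \<phi>) \<in> surface_atlas (quotient_surface \<Gamma>). P V \<phi>) \<longleftrightarrow>
      (\<forall>W. open W \<and> W \<subseteq> UU \<and> inj_on (orbit_proj \<Gamma>) W \<longrightarrow>
        P (orbit_proj \<Gamma> ` W) (inv_into W (orbit_proj \<Gamma>)))" for \<Gamma> P
    unfolding quotient_surface_def surface.simps by blast
  have top: "surface_topology (quotient_surface \<Gamma>) = quotient_topology \<Gamma>" for \<Gamma>
    by (simp add: quotient_surface_def)
  show ?thesis
    unfolding holomorphic_map_def atlas top by (rule conj_cong [OF refl]) blast
qed

text \<open>A chart is itself an inverse of the projection, so its inverse is the projection
  restricted to \<open>W\<close>; expressions in charts thereby become local lifts.\<close>

lemma inv_into_inv_into:
  assumes "inj_on f W" "r \<in> W"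
  shows "inv_into (f ` W) (inv_into W f) r = f r"
proof (rule inv_into_f_eq)
  show "inj_on (inv_into W f) (f ` W)" by (rule inj_on_inv_into) simp
qed (use assms in auto)

text \<open>Near a given point the chart expression of \<open>F\<close> is
  \<open>h \<circ> g\<close> for one fixed \<open>h\<close> of the second group, and this is
  affine.\<close>

lemma holomorphic_map_induced:
  assumes \<Gamma>': "subgroup \<Gamma>' AffU" and \<Gamma>'': "subgroup \<Gamma>'' AffU"
    and g: "g \<in> carrier AffU" and F: "\<And>p. p \<in> UU \<Longrightarrow> F (orbit_proj \<Gamma>' p) = orbit_proj \<Gamma>'' (g p)"
  shows "holomorphic_map (quotient_surface \<Gamma>') (quotient_surface \<Gamma>'') F"
proof -
  interpret A: AffU_subgroup \<Gamma>' by (rule AffU_subgroup.intro) (fact \<Gamma>')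
  interpret B: AffU_subgroup \<Gamma>'' by (rule AffU_subgroup.intro) (fact \<Gamma>'')
  have gU: "g p \<in> UU" if "p \<in> UU" for p using carrier_AffU_D(1) [OF g] that by blast
  have "continuous_map (top_of_set UU) (top_of_set UU) g"
    using carrier_AffU_D(2) [OF g] gU by auto
  then have "continuous_map (top_of_set UU) (quotient_topology \<Gamma>'') (orbit_proj \<Gamma>'' \<circ> g)"
    using B.continuous_map_orbit_proj continuous_map_compose by blast
  then have "continuous_map (top_of_set UU) (quotient_topology \<Gamma>'') (F \<circ> orbit_proj \<Gamma>')"
    by (rule continuous_map_eq) (simp add: F)
  then have cont: "continuous_map (quotient_topology \<Gamma>') (quotient_topology \<Gamma>'') F"
    by (rule A.continuous_map_from_quotient)
  have "complex_differentiable_at (inv_into W'' (orbit_proj \<Gamma>'') \<circ> F \<circ>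
          inv_into (orbit_proj \<Gamma>' ` W') (inv_into W' (orbit_proj \<Gamma>')))
        (inv_into W' (orbit_proj \<Gamma>') x)"
    if W': "open W'" "W' \<subseteq> UU" "inj_on (orbit_proj \<Gamma>') W'"
      and W'': "open W''" "W'' \<subseteq> UU" "inj_on (orbit_proj \<Gamma>'') W''"
      and x: "x \<in> orbit_proj \<Gamma>' ` W'" "F x \<in> orbit_proj \<Gamma>'' ` W''" for W' W'' x
  proof -
    obtain p where p: "p \<in> W'" "x = orbit_proj \<Gamma>' p" using x by blast
    have "p \<in> UU" using p W' by blast
    then obtain q where q: "q \<in> W''" "orbit_proj \<Gamma>'' (g p) = orbit_proj \<Gamma>'' q"
      using x F p by auto
    \<comment> \<open>\<open>h\<close> moves \<open>g p\<close> to the representative of its orbit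
      in \<open>W''\<close>.\<close>
    then obtain h where h: "h \<in> \<Gamma>''" "q = h (g p)"
      by (auto simp: B.orbit_proj_eq_iff)
    have hc: "h \<circ> g \<in> carrier AffU"
      using monoid.m_closed [OF group.is_monoid [OF group_AffU] B.in_carrier [OF h(1)] g]
      by (simp add: AffU_def)
    note chart = inv_into_inv_into [OF W'(3)]
    show ?thesis
    proof (rule complex_differentiable_at_transform)
      show "complex_differentiable_at (h \<circ> g) (inv_into W' (orbit_proj \<Gamma>') x)"
        by (rule carrier_AffU_D(3) [OF hc])
      \<comment> \<open>On this neighbourhood \<open>h \<circ> g\<close> stays in
        \<open>W''\<close>, where a point is determined by its orbit.\<close>
      show "open (W' \<inter> (h \<circ> g) -` W'')"
        using W'(1) W''(1) open_vimage carrier_AffU_D(2) [OF hc] by blast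
      show "inv_into W' (orbit_proj \<Gamma>') x \<in> W' \<inter> (h \<circ> g) -` W''"
        using p q h W'(3) by simp
      fix r assume r: "r \<in> W' \<inter> (h \<circ> g) -` W''"
      then have "F (orbit_proj \<Gamma>' r) = orbit_proj \<Gamma>'' (h (g r))"
        using W'(2) F h by auto
      then show "(h \<circ> g) r = (inv_into W'' (orbit_proj \<Gamma>'') \<circ> F \<circ>
          inv_into (orbit_proj \<Gamma>' ` W') (inv_into W' (orbit_proj \<Gamma>'))) r"
        using r chart W''(3) by simp
    qed
  qed
  with cont show ?thesis
    unfolding holomorphic_map_quotient_iff by blast
qed

section \<open>Lifting to the universal covering\<close>

declare UU_iff [simp del]


text \<open>One neighbourhood condition expresses that the action is free and discontinuous:
  translates of \<open>W\<close> by distinct elements are disjoint, as evenly covered neighbourhoods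
  require.\<close>

locale covering_subgroup = AffU_subgroup +
  assumes free_discontinuous: "p \<in> UU \<Longrightarrow>
    \<exists>W. open W \<and> p \<in> W \<and> W \<subseteq> UU \<and> (\<forall>g\<in>\<Gamma>. \<forall>q\<in>W. g q \<in> W \<longrightarrow> g = id)"
begin

lemma slice:
  assumes "p \<in> UU"
  obtains W where "open W" "p \<in> W" "W \<subseteq> UU" "inj_on (orbit_proj \<Gamma>) W"
    "\<And>g q. g \<in> \<Gamma> \<Longrightarrow> q \<in> W \<Longrightarrow> g q \<in> W \<Longrightarrow> g = id"
proof -
  obtain W where W: "open W" "p \<in> W" "W \<subseteq> UU" "\<forall>g\<in>\<Gamma>. \<forall>q\<in>W. g q \<in> W \<longrightarrow> g = id"
    using free_discontinuous [OF assms] by blast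
  moreover have "inj_on (orbit_proj \<Gamma>) W"
  proof (rule inj_onI)
    fix q r assume *: "q \<in> W" "r \<in> W" "orbit_proj \<Gamma> q = orbit_proj \<Gamma> r"
    then obtain g where "g \<in> \<Gamma>" "r = g q" by (auto simp: orbit_proj_eq_iff)
    with * W(4) show "q = r" by auto
  qed
  ultimately show ?thesis using that by blast
qed

text \<open>Pulling the projection back along f turns lifting into a problem about a covering of the
  convex set UU by a subset of a normed space, to which the library applies.\<close>

definition pullback :: "(complex^2 \<Rightarrow> (complex^2) set) \<Rightarrow> ((complex^2) \<times> (complex^2)) set" where
  "pullback f = {(p, q). p \<in> UU \<and> q \<in> UU \<and> orbit_proj \<Gamma> q = f p}"

text \<open>The sheets over \<open>T\<close> are indexed by the group: (p, q) belongs to the sheet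
  of \<open>g\<close> when q lies in the translate of \<open>W\<close> by \<open>g\<close>. Freeness
  on \<open>W\<close> separates the sheets.\<close>

lemma covering_space_pullback:
  assumes f: "continuous_map (top_of_set UU) (quotient_topology \<Gamma>) f"
  shows "covering_space (pullback f) fst UU"
  unfolding covering_space_def
proof (intro conjI ballI)
  have f_im: "f p \<in> orbit_proj \<Gamma> ` UU" if "p \<in> UU" for p
    using f that by (auto simp: continuous_map_def)
  have f_open: "open {p \<in> UU. f p \<in> orbit_proj \<Gamma> ` W}" if "open W" "W \<subseteq> UU" for W
    using f openin_orbit_proj_image [OF that]
    by (auto simp: continuous_map_def openin_open_eq [OF open_UU])
  show "continuous_on (pullback f) fst"
    by (intro continuous_intros)
  show "fst ` pullback f = UU"
  proof (intro equalityI subsetI)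
    fix p assume "p \<in> UU"
    then obtain q where "q \<in> UU" "orbit_proj \<Gamma> q = f p" using f_im by fastforce
    with \<open>p \<in> UU\<close> have "(p, q) \<in> pullback f" by (simp add: pullback_def)
    then show "p \<in> fst ` pullback f" by force
  qed (auto simp: pullback_def)
  fix p assume "p \<in> UU"
  then obtain q where q: "q \<in> UU" "orbit_proj \<Gamma> q = f p" using f_im by fastforce
  obtain W where W: "open W" "q \<in> W" "W \<subseteq> UU" "inj_on (orbit_proj \<Gamma>) W"
    and free: "\<And>g q. g \<in> \<Gamma> \<Longrightarrow> q \<in> W \<Longrightarrow> g q \<in> W \<Longrightarrow> g = id"
    using slice [OF q(1)] by metis
  define T where "T = {p \<in> UU. f p \<in> orbit_proj \<Gamma> ` W}"
  define sheet where "sheet g = pullback f \<inter> T \<times> g ` W" for g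
  have T: "open T" "T \<subseteq> UU" "p \<in> T"
    using f_open W q \<open>p \<in> UU\<close> by (auto simp: T_def image_iff)
  \<comment> \<open>The lift of \<open>f\<close> over \<open>T\<close> with values in
    \<open>W\<close>; its continuity comes from the projection being open.\<close>
  define s where "s x = inv_into W (orbit_proj \<Gamma>) (f x)" for x
  have s: "s x \<in> W" "orbit_proj \<Gamma> (s x) = f x" if "x \<in> T" for x
    using that by (auto simp: T_def s_def inv_into_into f_inv_into_f)
  have s_eq: "s x = y" if "y \<in> W" "orbit_proj \<Gamma> y = f x" for x y
    using that W(4) by (simp add: s_def flip: that(2))
  have cont_s: "continuous_on T s"
    unfolding continuous_on_open_vimage [OF T(1)]
  proof (intro allI impI)
    fix B :: "(complex^2) set" assume "open B"
    have "s -` B \<inter> T = {x \<in> UU. f x \<in> orbit_proj \<Gamma> ` (W \<inter> B)}"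
    proof (intro equalityI subsetI)
      fix x assume "x \<in> s -` B \<inter> T"
      then show "x \<in> {x \<in> UU. f x \<in> orbit_proj \<Gamma> ` (W \<inter> B)}"
        using s [of x] T(2) by (auto simp: image_iff)
    next
      fix x assume "x \<in> {x \<in> UU. f x \<in> orbit_proj \<Gamma> ` (W \<inter> B)}"
      then obtain y where "x \<in> UU" "y \<in> W" "y \<in> B" "orbit_proj \<Gamma> y = f x" by auto
      then show "x \<in> s -` B \<inter> T"
        using s_eq [of y x] by (auto simp: T_def image_iff)
    qed
    moreover have "open \<dots>"
      using f_open [of "W \<inter> B"] W \<open>open B\<close> by blast
    ultimately show "open (s -` B \<inter> T)" by simp
  qed
  show "\<exists>T. p \<in> T \<and> openin (top_of_set UU) T \<and>
      (\<exists>v. \<Union> v = pullback f \<inter> fst -` T \<and> (\<forall>u\<in>v. openin (top_of_set (pullback f)) u) \<and>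
        disjoint v \<and> (\<forall>u\<in>v. \<exists>q. homeomorphism u T fst q))"
  proof (intro exI [of _ T] exI [of _ "sheet ` \<Gamma>"] conjI ballI)
    show "p \<in> T" by (rule T)
    show "openin (top_of_set UU) T" using T by (simp add: openin_open_eq [OF open_UU])
    show "\<Union> (sheet ` \<Gamma>) = pullback f \<inter> fst -` T"
    proof (intro equalityI subsetI)
      fix z assume z: "z \<in> pullback f \<inter> fst -` T"
      then obtain w where "w \<in> W" "orbit_proj \<Gamma> w = orbit_proj \<Gamma> (snd z)"
        by (auto simp: pullback_def T_def)
      then obtain g where "g \<in> \<Gamma>" "snd z = g w" by (auto simp: orbit_proj_eq_iff)
      with z \<open>w \<in> W\<close> have "z \<in> sheet g" by (cases z) (auto simp: sheet_def)
      with \<open>g \<in> \<Gamma>\<close> show "z \<in> \<Union> (sheet ` \<Gamma>)" by blast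
    qed (auto simp: sheet_def)
    show "openin (top_of_set (pullback f)) u" if "u \<in> sheet ` \<Gamma>" for u
      using that T W open_image_AffU in_carrier
      by (auto simp: sheet_def intro!: openin_open_Int open_Times)
    \<comment> \<open>If two sheets meet, \<open>inv_AffU h \<circ> g\<close> carries a point of
      \<open>W\<close> into \<open>W\<close> and is therefore the identity.\<close>
    have same: "g = h" if g: "g \<in> \<Gamma>" "h \<in> \<Gamma>" and z: "z \<in> sheet g" "z \<in> sheet h" for g h z
    proof -
      obtain w w' where w: "w \<in> W" "w' \<in> W" "g w = h w'"
        using z by (auto simp: sheet_def)
      then have "(inv_AffU h \<circ> g) w = w'" using g by (simp add: inv_apply)
      then have "inv_AffU h \<circ> g = id"
        using free [of "inv_AffU h \<circ> g" w] g w comp_mem inv_mem by metis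
      then have "h (inv_AffU h (g x)) = h x" for x by (simp add: fun_eq_iff)
      then show "g = h" using g by (simp add: inv_apply fun_eq_iff)
    qed
    show "disjoint (sheet ` \<Gamma>)"
      unfolding disjoint_def using same by blast
    fix u assume "u \<in> sheet ` \<Gamma>"
    then obtain g where g: "g \<in> \<Gamma>" "u = sheet g" by blast
    have "homeomorphism (sheet g) T fst (\<lambda>x. (x, g (s x)))"
    proof (rule homeomorphismI)
      show "continuous_on (sheet g) fst" by (intro continuous_intros)
      show "continuous_on T (\<lambda>x. (x, g (s x)))"
        by (intro continuous_on_Pair continuous_on_id continuous_on_compose2 [OF carrier_AffU_D(2) [where S = UNIV] cont_s]
            in_carrier g subset_UNIV)
      show "fst ` sheet g \<subseteq> T" by (auto simp: sheet_def)
      show "(\<lambda>x. (x, g (s x))) ` T \<subseteq> sheet g"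
      proof clarify
        fix x assume x: "x \<in> T"
        then have "s x \<in> W" "x \<in> UU" "g (s x) \<in> UU" "orbit_proj \<Gamma> (g (s x)) = f x"
          using s [OF x] T(2) W(3) maps_UU [OF g(1), of "s x"] g(1) by auto
        then show "(x, g (s x)) \<in> sheet g"
          using x by (simp add: sheet_def pullback_def)
      qed
      show "(fst z, g (s (fst z))) = z" if z0: "z \<in> sheet g" for z
      proof -
        obtain x w where z: "z = (x, g w)" "w \<in> W" "orbit_proj \<Gamma> (g w) = f x"
          using z0 by (auto simp: sheet_def pullback_def)
        then show ?thesis using s_eq [of w x] g by simp
      qed
      show "fst (x, g (s x)) = x" for x by simp
    qed
    then show "\<exists>q. homeomorphism u T fst q" using g by blast
  qed
qed

section \<open>Existence and uniqueness of lifts\<close>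

lemma simply_connected_UU: "simply_connected UU" "locally path_connected UU"
  using convex_UU by (auto intro: convex_imp_simply_connected convex_imp_locally_path_connected)

text \<open>A lift of the identity of \<open>UU\<close> through the pullback covering is a section;
  its second component is a lift of \<open>f\<close>.\<close>

lemma lift_exists:
  assumes f: "continuous_map (top_of_set UU) (quotient_topology \<Gamma>) f"
    and "p \<in> UU" "q \<in> UU" "orbit_proj \<Gamma> q = f p"
  obtains h where "continuous_on UU h" "h \<in> UU \<rightarrow> UU" "h p = q"
    "\<And>x. x \<in> UU \<Longrightarrow> orbit_proj \<Gamma> (h x) = f x"
proof -
  have "(p, q) \<in> pullback f" "id p = fst (p, q)" "id \<in> UU \<rightarrow> UU" "continuous_on UU id"
    using assms by (auto simp: pullback_def)
  then obtain g where g: "continuous_on UU g" "g \<in> UU \<rightarrow> pullback f" "g p = (p, q)"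
      "\<And>x. x \<in> UU \<Longrightarrow> fst (g x) = id x"
    using covering_space_lift_strong [OF covering_space_pullback [OF f] _ \<open>p \<in> UU\<close>
        simply_connected_UU, of "(p, q)" id] by metis
  show thesis
  proof (rule that)
    show "continuous_on UU (\<lambda>x. snd (g x))" by (intro continuous_on_snd g)
    have "(x, snd (g x)) \<in> pullback f" if "x \<in> UU" for x
      using g(2,4) that by (metis Pi_mem id_apply prod.collapse)
    then show "(\<lambda>x. snd (g x)) \<in> UU \<rightarrow> UU"
      "\<And>x. x \<in> UU \<Longrightarrow> orbit_proj \<Gamma> (snd (g x)) = f x"
      by (auto simp: pullback_def)
    show "snd (g p) = q" using g by simp
  qed
qed

text \<open>The graphs of \<open>h\<close> and \<open>k\<close> both lift the identity to the
  pullback of their common projection, where uniqueness of lifts on the connected set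
  \<open>UU\<close> applies.\<close>

lemma lift_unique:
  assumes h: "continuous_on UU h" "h \<in> UU \<rightarrow> UU" and k: "continuous_on UU k" "k \<in> UU \<rightarrow> UU"
    and same: "\<And>x. x \<in> UU \<Longrightarrow> orbit_proj \<Gamma> (h x) = orbit_proj \<Gamma> (k x)"
    and "p \<in> UU" "h p = k p" "x \<in> UU"
  shows "h x = k x"
proof -
  define f where "f = orbit_proj \<Gamma> \<circ> h"
  have "continuous_map (top_of_set UU) (top_of_set UU) h" using h by auto
  then have "continuous_map (top_of_set UU) (quotient_topology \<Gamma>) f"
    unfolding f_def using continuous_map_orbit_proj continuous_map_compose by blast
  then have cov: "covering_space (pullback f) fst UU" by (rule covering_space_pullback)
  have "(x, h x) = (x, k x)"
  proof (rule covering_space_lift_unique [OF cov, where f = id and T = UU and a = p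
        and ?g1.0 = "\<lambda>x. (x, h x)" and ?g2.0 = "\<lambda>x. (x, k x)" and x = x])
    show "connected UU" using convex_UU convex_connected by blast
    show "continuous_on UU (\<lambda>x. (x, h x))" "continuous_on UU (\<lambda>x. (x, k x))"
      by (intro continuous_intros h k)+
    show "(\<lambda>x. (x, h x)) \<in> UU \<rightarrow> pullback f" "(\<lambda>x. (x, k x)) \<in> UU \<rightarrow> pullback f"
      using h k same by (auto simp: pullback_def f_def)
  qed (use assms in auto)
  then show ?thesis by simp
qed

end

text \<open>\<Phi> \<circ> g and h \<circ> \<Phi> lift the same map, so it is enough to choose
  \<open>h\<close> such that they agree at one point.\<close>

lemma lift_equivariant:
  assumes "covering_subgroup \<Gamma>'" "covering_subgroup \<Gamma>''"
    and \<Phi>: "continuous_on UU \<Phi>" "\<Phi> \<in> UU \<rightarrow> UU"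
    and lift: "\<And>p. p \<in> UU \<Longrightarrow> orbit_proj \<Gamma>'' (\<Phi> p) = F (orbit_proj \<Gamma>' p)"
    and g: "g \<in> \<Gamma>'"
  shows "\<exists>h\<in>\<Gamma>''. \<forall>p\<in>UU. \<Phi> (g p) = h (\<Phi> p)"
proof -
  interpret A: covering_subgroup \<Gamma>' by fact
  interpret B: covering_subgroup \<Gamma>'' by fact
  define o' :: "complex^2" where "o' = vector [\<i>, 0]"
  have o': "o' \<in> UU" by (simp add: UU_iff o'_def)
  have gU: "g p \<in> UU" if "p \<in> UU" for p using g that by (rule A.maps_UU)
  have eq: "orbit_proj \<Gamma>'' (\<Phi> p) = orbit_proj \<Gamma>'' (\<Phi> (g p))" if "p \<in> UU" for p
    using lift [OF that] lift [OF gU [OF that]] g by simp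
  from eq [OF o'] obtain h where h: "h \<in> \<Gamma>''" "\<Phi> (g o') = h (\<Phi> o')"
    unfolding B.orbit_proj_eq_iff by blast
  have "\<Phi> (g p) = h (\<Phi> p)" if "p \<in> UU" for p
  proof (rule B.lift_unique [where h = "\<lambda>p. \<Phi> (g p)" and k = "\<lambda>p. h (\<Phi> p)" and p = o'])
    show "continuous_on UU (\<lambda>p. \<Phi> (g p))"
      using gU by (intro continuous_on_compose2 [OF \<Phi>(1)] carrier_AffU_D(2) A.in_carrier g) auto
    show "continuous_on UU (\<lambda>p. h (\<Phi> p))"
      by (intro continuous_on_compose2 [OF carrier_AffU_D(2) [where S = UNIV] \<Phi>(1)] B.in_carrier h subset_UNIV)
    show "(\<lambda>p. \<Phi> (g p)) \<in> UU \<rightarrow> UU" using gU \<Phi>(2) by blast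
    show "(\<lambda>p. h (\<Phi> p)) \<in> UU \<rightarrow> UU" using B.maps_UU [OF h(1)] \<Phi>(2) by blast
  qed (use h eq o' that in auto)
  then show ?thesis using h by auto
qed

text \<open>With charts chosen around p and \<Phi>(p), the chart expression of \<open>F\<close> near
  p is \<Phi> itself.\<close>

lemma lift_differentiable:
  assumes "covering_subgroup \<Gamma>'" "covering_subgroup \<Gamma>''"
    and F: "holomorphic_map (quotient_surface \<Gamma>') (quotient_surface \<Gamma>'') F"
    and \<Phi>: "continuous_on UU \<Phi>" "\<Phi> \<in> UU \<rightarrow> UU"
    and lift: "\<And>p. p \<in> UU \<Longrightarrow> orbit_proj \<Gamma>'' (\<Phi> p) = F (orbit_proj \<Gamma>' p)"
    and p: "p \<in> UU"
  shows "complex_differentiable_at \<Phi> p"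
proof -
  interpret A: covering_subgroup \<Gamma>' by fact
  interpret B: covering_subgroup \<Gamma>'' by fact
  obtain W' where W': "open W'" "p \<in> W'" "W' \<subseteq> UU" "inj_on (orbit_proj \<Gamma>') W'"
    using A.slice [OF p] by metis
  have "\<Phi> p \<in> UU" using p \<Phi>(2) by blast
  then obtain W'' where W'': "open W''" "\<Phi> p \<in> W''" "W'' \<subseteq> UU" "inj_on (orbit_proj \<Gamma>'') W''"
    using B.slice by metis
  note chart = inv_into_inv_into [OF W'(4)]
  let ?F = "inv_into W'' (orbit_proj \<Gamma>'') \<circ> F \<circ>
    inv_into (orbit_proj \<Gamma>' ` W') (inv_into W' (orbit_proj \<Gamma>'))"
  show ?thesis
  proof (rule complex_differentiable_at_transform)
    have "complex_differentiable_at ?F (inv_into W' (orbit_proj \<Gamma>') (orbit_proj \<Gamma>' p))"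
      using F W' W'' lift [OF p] unfolding holomorphic_map_quotient_iff by (metis imageI)
    then show "complex_differentiable_at ?F p"
      using W' by simp
    have "open (\<Phi> -` W'' \<inter> UU)"
      using \<Phi>(1) W''(1) unfolding continuous_on_open_vimage [OF open_UU] by blast
    then show "open (W' \<inter> (\<Phi> -` W'' \<inter> UU))" using W'(1) by blast
    show "p \<in> W' \<inter> (\<Phi> -` W'' \<inter> UU)" using p W' W'' by blast
    fix r assume r: "r \<in> W' \<inter> (\<Phi> -` W'' \<inter> UU)"
    then have "F (orbit_proj \<Gamma>' r) = orbit_proj \<Gamma>'' (\<Phi> r)" using lift by auto
    then show "?F r = \<Phi> r" using r chart W''(4) by simp
  qed
qed

text \<open>Lifts of \<open>F\<close> and \<open>G\<close> with matching base points are mutually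
  inverse: each composite and the identity lift the same projection and agree at a base
  point.\<close>

lemma biholomorphic_lift:
  assumes A: "covering_subgroup \<Gamma>'" and B: "covering_subgroup \<Gamma>''"
    and bih: "biholomorphic (quotient_surface \<Gamma>') (quotient_surface \<Gamma>'')"
  obtains \<Phi> \<Psi> where
    "\<And>p. p \<in> UU \<Longrightarrow> \<Phi> p \<in> UU" "\<And>p. p \<in> UU \<Longrightarrow> complex_differentiable_at \<Phi> p"
    "\<And>p. p \<in> UU \<Longrightarrow> \<Psi> p \<in> UU" "\<And>p. p \<in> UU \<Longrightarrow> complex_differentiable_at \<Psi> p"
    "\<And>p. p \<in> UU \<Longrightarrow> \<Psi> (\<Phi> p) = p" "\<And>p. p \<in> UU \<Longrightarrow> \<Phi> (\<Psi> p) = p"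
    "\<And>g. g \<in> \<Gamma>' \<Longrightarrow> \<exists>h\<in>\<Gamma>''. \<forall>p\<in>UU. \<Phi> (g p) = h (\<Phi> p)"
    "\<And>h. h \<in> \<Gamma>'' \<Longrightarrow> \<exists>g\<in>\<Gamma>'. \<forall>p\<in>UU. \<Phi> (g p) = h (\<Phi> p)"
proof -
  interpret A: covering_subgroup \<Gamma>' by fact
  interpret B: covering_subgroup \<Gamma>'' by fact
  have top: "surface_topology (quotient_surface \<Gamma>) = quotient_topology \<Gamma>" for \<Gamma>
    by (simp add: quotient_surface_def)
  obtain F G where F: "holomorphic_map (quotient_surface \<Gamma>') (quotient_surface \<Gamma>'') F"
    and G: "holomorphic_map (quotient_surface \<Gamma>'') (quotient_surface \<Gamma>') G"
    and "\<forall>x\<in>topspace (surface_topology (quotient_surface \<Gamma>')). G (F x) = x"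
      "\<forall>y\<in>topspace (surface_topology (quotient_surface \<Gamma>'')). F (G y) = y"
    using bih unfolding biholomorphic_def by blast
  then have GF: "\<And>p. p \<in> UU \<Longrightarrow> G (F (orbit_proj \<Gamma>' p)) = orbit_proj \<Gamma>' p"
    and FG: "\<And>p. p \<in> UU \<Longrightarrow> F (G (orbit_proj \<Gamma>'' p)) = orbit_proj \<Gamma>'' p"
    by (auto simp: top)
  have F_cont: "continuous_map (top_of_set UU) (quotient_topology \<Gamma>'') (F \<circ> orbit_proj \<Gamma>')"
    using F [unfolded holomorphic_map_quotient_iff, THEN conjunct1]
    by (rule continuous_map_compose [OF A.continuous_map_orbit_proj])
  have G_cont: "continuous_map (top_of_set UU) (quotient_topology \<Gamma>') (G \<circ> orbit_proj \<Gamma>'')"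
    using G [unfolded holomorphic_map_quotient_iff, THEN conjunct1]
    by (rule continuous_map_compose [OF B.continuous_map_orbit_proj])
  define o' :: "complex^2" where "o' = vector [\<i>, 0]"
  have o': "o' \<in> UU" by (simp add: UU_iff o'_def)
  have "(F \<circ> orbit_proj \<Gamma>') o' \<in> orbit_proj \<Gamma>'' ` UU"
    using F_cont o' unfolding continuous_map_def B.topspace_quotient topspace_euclidean_subtopology
    by blast
  then obtain o'' where o'': "o'' \<in> UU" "orbit_proj \<Gamma>'' o'' = (F \<circ> orbit_proj \<Gamma>') o'"
    by auto
  obtain \<Phi> where \<Phi>: "continuous_on UU \<Phi>" "\<Phi> \<in> UU \<rightarrow> UU" "\<Phi> o' = o''"
    and "\<And>x. x \<in> UU \<Longrightarrow> orbit_proj \<Gamma>'' (\<Phi> x) = (F \<circ> orbit_proj \<Gamma>') x"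
    using B.lift_exists [OF F_cont o' o''] by metis
  then have \<Phi>F: "\<And>x. x \<in> UU \<Longrightarrow> orbit_proj \<Gamma>'' (\<Phi> x) = F (orbit_proj \<Gamma>' x)" by simp
  have "orbit_proj \<Gamma>' o' = (G \<circ> orbit_proj \<Gamma>'') o''"
    using o'' GF [OF o'] by simp
  then obtain \<Psi> where \<Psi>: "continuous_on UU \<Psi>" "\<Psi> \<in> UU \<rightarrow> UU" "\<Psi> o'' = o'"
    and "\<And>x. x \<in> UU \<Longrightarrow> orbit_proj \<Gamma>' (\<Psi> x) = (G \<circ> orbit_proj \<Gamma>'') x"
    using A.lift_exists [OF G_cont o''(1) o'] by metis
  then have \<Psi>G: "\<And>x. x \<in> UU \<Longrightarrow> orbit_proj \<Gamma>' (\<Psi> x) = G (orbit_proj \<Gamma>'' x)" by simp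
  have \<Phi>U: "\<And>p. p \<in> UU \<Longrightarrow> \<Phi> p \<in> UU" and \<Psi>U: "\<And>p. p \<in> UU \<Longrightarrow> \<Psi> p \<in> UU"
    using \<Phi> \<Psi> by blast+
  have \<Psi>\<Phi>: "\<Psi> (\<Phi> p) = p" if "p \<in> UU" for p
  proof (rule A.lift_unique [where h = "\<lambda>p. \<Psi> (\<Phi> p)" and k = "\<lambda>p. p" and p = o'])
    show "continuous_on UU (\<lambda>p. \<Psi> (\<Phi> p))"
      using \<Phi>U by (intro continuous_on_compose2 [OF \<Psi>(1) \<Phi>(1)]) blast
  qed (use \<Phi> \<Psi> \<Phi>U \<Psi>U \<Phi>F \<Psi>G GF o' that in \<open>auto simp del: UU_iff\<close>)
  have \<Phi>\<Psi>: "\<Phi> (\<Psi> p) = p" if "p \<in> UU" for p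
  proof (rule B.lift_unique [where h = "\<lambda>p. \<Phi> (\<Psi> p)" and k = "\<lambda>p. p" and p = o''])
    show "continuous_on UU (\<lambda>p. \<Phi> (\<Psi> p))"
      using \<Psi>U by (intro continuous_on_compose2 [OF \<Phi>(1) \<Psi>(1)]) blast
  qed (use \<Phi> \<Psi> \<Phi>U \<Psi>U \<Phi>F \<Psi>G FG o'' that in \<open>auto simp del: UU_iff\<close>)
  show thesis
  proof (rule that)
    show "complex_differentiable_at \<Phi> p" if "p \<in> UU" for p
      by (rule lift_differentiable [OF A B F \<Phi>(1,2) \<Phi>F that])
    show "complex_differentiable_at \<Psi> p" if "p \<in> UU" for p
      by (rule lift_differentiable [OF B A G \<Psi>(1,2) \<Psi>G that])
    show "\<exists>h\<in>\<Gamma>''. \<forall>p\<in>UU. \<Phi> (g p) = h (\<Phi> p)" if "g \<in> \<Gamma>'" for g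
      by (rule lift_equivariant [OF A B \<Phi>(1,2) \<Phi>F that])
    show "\<exists>g\<in>\<Gamma>'. \<forall>p\<in>UU. \<Phi> (g p) = h (\<Phi> p)" if h: "h \<in> \<Gamma>''" for h
    proof -
      \<comment> \<open>Equivariance of \<Psi>, rewritten through \<Phi>, shows that every
        \<open>h\<close> of the second group is reached.\<close>
      obtain g where g: "g \<in> \<Gamma>'" "\<And>q. q \<in> UU \<Longrightarrow> \<Psi> (h q) = g (\<Psi> q)"
        using lift_equivariant [OF B A \<Psi>(1,2) \<Psi>G h] by blast
      have "\<Phi> (g p) = h (\<Phi> p)" if "p \<in> UU" for p
        using g(2) [OF \<Phi>U [OF that]] \<Psi>\<Phi> [OF that] \<Phi>\<Psi> [OF B.maps_UU [OF h \<Phi>U [OF that]]] by simp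
      with g show ?thesis by blast
    qed
  qed (fact \<Phi>U \<Psi>U \<Psi>\<Phi> \<Phi>\<Psi>)+
qed

section \<open>Lattices in Inoue groups\<close>

text \<open>Because \<open>g\<close> normalises \<Lambda>, powers of \<open>g\<close> can be
  collected on the right. Both \<open>left\<close> and \<open>right\<close> are used: the first
  alone allows g \<Lambda> g^-1 to be a proper subgroup of \<Lambda>, and then negative powers could
  not be moved.\<close>

lemma (in group) generate_insert_subset:
  assumes \<Lambda>: "subgroup \<Lambda> G" and g: "g \<in> carrier G"
    and left: "\<And>h. h \<in> \<Lambda> \<Longrightarrow> \<exists>h'\<in>\<Lambda>. g \<otimes> h = h' \<otimes> g"
    and right: "\<And>h. h \<in> \<Lambda> \<Longrightarrow> \<exists>h'\<in>\<Lambda>. h \<otimes> g = g \<otimes> h'"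
  shows "generate G (insert g \<Lambda>) \<subseteq> {h \<otimes> g [^] (n::int) |h n. h \<in> \<Lambda>}"
proof -
  note [simp] = subgroup.mem_carrier [OF \<Lambda>] g
  have pow_left: "\<exists>h'\<in>\<Lambda>. g [^] n \<otimes> h = h' \<otimes> g [^] n" if "h \<in> \<Lambda>" for h and n :: nat
    using that
  proof (induction n arbitrary: h)
    case (Suc n)
    obtain h1 where h1: "h1 \<in> \<Lambda>" "g \<otimes> h = h1 \<otimes> g" using left [OF Suc.prems] by blast
    obtain h2 where h2: "h2 \<in> \<Lambda>" "g [^] n \<otimes> h1 = h2 \<otimes> g [^] n" using Suc.IH [OF h1(1)] by blast
    have "g [^] Suc n \<otimes> h = g [^] n \<otimes> (g \<otimes> h)" using Suc.prems by (simp add: m_assoc)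
    also have "\<dots> = (g [^] n \<otimes> h1) \<otimes> g" using h1 by (simp add: m_assoc)
    also have "\<dots> = h2 \<otimes> g [^] Suc n" using h2 by (simp add: m_assoc)
    finally show ?case using h2 by blast
  qed auto
  have pow_right: "\<exists>h'\<in>\<Lambda>. h \<otimes> g [^] n = g [^] n \<otimes> h'" if "h \<in> \<Lambda>" for h and n :: nat
    using that
  proof (induction n arbitrary: h)
    case (Suc n)
    obtain h1 where h1: "h1 \<in> \<Lambda>" "h \<otimes> g [^] n = g [^] n \<otimes> h1" using Suc.IH [OF Suc.prems] by blast
    obtain h2 where h2: "h2 \<in> \<Lambda>" "h1 \<otimes> g = g \<otimes> h2" using right [OF h1(1)] by blast
    have "h \<otimes> g [^] Suc n = (h \<otimes> g [^] n) \<otimes> g" using Suc.prems by (simp add: m_assoc)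
    also have "\<dots> = g [^] n \<otimes> (h1 \<otimes> g)" using h1 by (simp add: m_assoc)
    also have "\<dots> = g [^] Suc n \<otimes> h2" using h2 by (simp add: m_assoc)
    finally show ?case using h2 by blast
  qed auto
  have int_pow: "\<exists>h'\<in>\<Lambda>. g [^] n \<otimes> h = h' \<otimes> g [^] n" if h: "h \<in> \<Lambda>" for h and n :: int
  proof (cases n rule: int_cases2)
    case (nonneg k)
    then show ?thesis using pow_left [OF h, of k] by (simp add: int_pow_int)
  next
    case (nonpos k)
    \<comment> \<open>A negative power is moved past \<open>h\<close> by multiplying this relation
      with the inverse power on both sides.\<close>
    obtain h' where h': "h' \<in> \<Lambda>" "h \<otimes> g [^] k = g [^] k \<otimes> h'" using pow_right [OF h] by blast
    have "inv (g [^] k) \<otimes> h = inv (g [^] k) \<otimes> (h \<otimes> g [^] k) \<otimes> inv (g [^] k)"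
      using h by (simp add: m_assoc)
    also have "\<dots> = h' \<otimes> inv (g [^] k)"
      using h' by (simp add: m_assoc [symmetric])
    finally show ?thesis using h' nonpos by (auto simp: int_pow_neg_int)
  qed
  let ?K = "{h \<otimes> g [^] (n::int) |h n. h \<in> \<Lambda>}"
  have "subgroup ?K G"
  proof (rule subgroupI)
    show "?K \<subseteq> carrier G" by auto
    show "?K \<noteq> {}" using subgroup.one_closed [OF \<Lambda>] by blast
    fix x assume "x \<in> ?K"
    then obtain h and n :: int where x: "x = h \<otimes> g [^] n" "h \<in> \<Lambda>" by blast
    obtain h' where h': "h' \<in> \<Lambda>" "g [^] (- n) \<otimes> inv h = h' \<otimes> g [^] (- n)"
      using int_pow subgroup.m_inv_closed [OF \<Lambda> x(2)] by blast
    have "inv x = g [^] (- n) \<otimes> inv h"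
      using x by (simp add: inv_mult_group int_pow_neg)
    with h' show "inv x \<in> ?K" by auto
    fix y assume "y \<in> ?K"
    then obtain k and j :: int where y: "y = k \<otimes> g [^] j" "k \<in> \<Lambda>" by blast
    obtain k' where k': "k' \<in> \<Lambda>" "g [^] n \<otimes> k = k' \<otimes> g [^] n"
      using int_pow y(2) by blast
    have "x \<otimes> y = h \<otimes> (g [^] n \<otimes> k) \<otimes> g [^] j"
      using x y by (simp add: m_assoc)
    also have "\<dots> = (h \<otimes> k') \<otimes> (g [^] n \<otimes> g [^] j)"
      using x y k' by (simp add: m_assoc)
    also have "\<dots> = (h \<otimes> k') \<otimes> g [^] (n + j)"
      by (simp add: int_pow_mult)
    finally show "x \<otimes> y \<in> ?K"
      using subgroup.m_closed [OF \<Lambda> x(2) k'(1)] by blast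
  qed
  moreover have "insert g \<Lambda> \<subseteq> ?K"
  proof -
    have "g = \<one> \<otimes> g [^] (1::int)" by (simp add: int_pow_1)
    moreover have "h = h \<otimes> g [^] (0::int)" if "h \<in> \<Lambda>" for h using that by simp
    ultimately show ?thesis using subgroup.one_closed [OF \<Lambda>] by blast
  qed
  ultimately show ?thesis by (rule generate_subgroup_incl [rotated])
qed

section \<open>Triangular maps and discontinuity\<close>

lemma mult_AffU [simp]: "f \<otimes>\<^bsub>AffU\<^esub> g = f \<circ> g" and one_AffU [simp]: "\<one>\<^bsub>AffU\<^esub> = id"
  by (simp_all add: AffU_def)

text \<open>The common shape of all generators, closed under composition; \<open>l\<close> and
  \<open>x\<close> are real so that Im w is only multiplied by \<open>l\<close>.\<close>

definition tri :: "real \<Rightarrow> real \<Rightarrow> complex \<Rightarrow> complex \<Rightarrow> complex \<Rightarrow> complex^2 \<Rightarrow> complex^2" where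
  "tri l x k n s = (\<lambda>p. vector [of_real l * p$1 + of_real x, k * p$2 + n * p$1 + s])"

lemma tri_nth [simp]:
  "tri l x k n s p $ 1 = of_real l * p$1 + of_real x" "tri l x k n s p $ 2 = k * p$2 + n * p$1 + s"
  by (simp_all add: tri_def)

lemma tri_carrier: "l > 0 \<Longrightarrow> k \<noteq> 0 \<Longrightarrow> tri l x k n s \<in> carrier AffU"
  by (rule AffU_memI [of _ l x n k s]) (auto simp: tri_def vec_eq_iff forall_2)

lemma tri_comp:
  "tri l x k n s \<circ> tri l' x' k' n' s' =
    tri (l * l') (l * x' + x) (k * k') (k * n' + n * of_real l') (k * s' + n * of_real x' + s)"
  by (rule ext) (simp add: vec_eq_iff forall_2 algebra_simps)

lemma tri_id: "tri 1 0 1 0 0 = id"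
  by (rule ext) (simp add: vec_eq_iff forall_2)

text \<open>The powers are told apart by their effect on Im w, so the first coordinate is
  enough.\<close>

lemma int_pow_tri_fst:
  assumes "l > 0" "k \<noteq> 0"
  shows "(tri l 0 k 0 t [^]\<^bsub>AffU\<^esub> (n::int)) p $ 1 = of_real (l powi n) * p $ 1"
proof -
  interpret group AffU by (rule group_AffU)
  let ?g = "tri l 0 k 0 t"
  have c: "?g \<in> carrier AffU" using assms by (rule tri_carrier)
  have nat: "(?g [^]\<^bsub>AffU\<^esub> (n::nat)) p $ 1 = of_real (l ^ n) * p $ 1" for n p
    by (induction n arbitrary: p) (auto simp: AffU_def algebra_simps)
  show ?thesis
  proof (cases n rule: int_cases2)
    case (nonneg m)
    then show ?thesis using nat by (simp add: int_pow_int)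
  next
    case (nonpos m)
    let ?h = "?g [^]\<^bsub>AffU\<^esub> m"
    have "?h (inv_AffU ?h p) $ 1 = p $ 1"
      using carrier_AffU_D(6) [OF nat_pow_closed [OF c]] by simp
    then have "of_real (l ^ m) * inv_AffU ?h p $ 1 = p $ 1"
      unfolding nat .
    then show ?thesis
      using nonpos assms c by (simp add: int_pow_neg_int power_int_minus field_simps)
  qed
qed

text \<open>Members of \<Lambda> preserve Im w and the n-th power of the scaling multiplies it by
  \<open>l powi n\<close>. A horizontal strip whose ends have ratio \<open>l\<close> leaves only n =
  0, and then the neighbourhood given by \<open>disc\<close> applies.\<close>

lemma covering_subgroup_semidirect:
  assumes sub: "subgroup \<Gamma> AffU" and l: "l > 1" and k: "k \<noteq> 0"
    and \<Gamma>: "\<And>\<gamma>. \<gamma> \<in> \<Gamma> \<Longrightarrow> \<exists>h\<in>\<Lambda>. \<exists>n::int. \<gamma> = h \<circ> (tri l 0 k 0 t [^]\<^bsub>AffU\<^esub> n)"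
    and \<Lambda>: "\<And>h. h \<in> \<Lambda> \<Longrightarrow> \<exists>x::real. \<forall>p. h p $ 1 = p $ 1 + of_real x"
    and disc: "\<And>p. p \<in> UU \<Longrightarrow> \<exists>W. open W \<and> p \<in> W \<and> W \<subseteq> UU \<and> (\<forall>h\<in>\<Lambda>. \<forall>q\<in>W. h q \<in> W \<longrightarrow> h = id)"
  shows "covering_subgroup \<Gamma>"
proof (intro covering_subgroup.intro AffU_subgroup.intro covering_subgroup_axioms.intro sub)
  fix p assume p: "p \<in> UU"
  interpret group AffU by (rule group_AffU)
  define b where "b = Im (p $ 1)"
  have b: "0 < b" using p by (simp add: b_def UU_iff)
  \<comment> \<open>The height \<open>b\<close> lies inside because 2 / (1 + l) < 1 < 2 l / (1 + l).
    The strip is open with end ratio exactly \<open>l\<close>, so no nonzero power maps one of its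
    points back into it.\<close>
  define strip where "strip = {q :: complex^2. 2 * b / (1 + l) < Im (q $ 1) \<and> Im (q $ 1) < l * (2 * b / (1 + l))}"
  have "strip = {q. 2 * b / (1 + l) < Im (q $ 1)} \<inter> {q. Im (q $ 1) < l * (2 * b / (1 + l))}"
    by (auto simp: strip_def)
  then have "open strip"
    by (simp only:) (intro open_Int open_Collect_less continuous_intros continuous_on_component)
  have "p \<in> strip"
    using b l by (simp add: strip_def flip: b_def) (simp add: field_simps)
  obtain W where W: "open W" "p \<in> W" "W \<subseteq> UU" "\<forall>h\<in>\<Lambda>. \<forall>q\<in>W. h q \<in> W \<longrightarrow> h = id"
    using disc [OF p] by blast
  have "\<gamma> = id" if \<gamma>: "\<gamma> \<in> \<Gamma>" and q: "q \<in> W \<inter> strip" "\<gamma> q \<in> W \<inter> strip" for \<gamma> q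
  proof -
    obtain h and n :: int where h: "h \<in> \<Lambda>" "\<gamma> = h \<circ> (tri l 0 k 0 t [^]\<^bsub>AffU\<^esub> n)"
      using \<Gamma> [OF \<gamma>] by blast
    obtain x :: real where x: "\<And>p. h p $ 1 = p $ 1 + of_real x" using \<Lambda> [OF h(1)] by blast
    have Im: "Im (\<gamma> q $ 1) = l powi n * Im (q $ 1)"
      using l k by (simp add: h(2) x int_pow_tri_fst del: of_real_power_int)
    have lb: "0 < 2 * b / (1 + l)" using b l by simp
    then have pos: "0 < Im (q $ 1)" "0 < Im (\<gamma> q $ 1)"
      using q by (auto simp: strip_def)
    have "n = 0"
    proof (rule ccontr)
      assume "n \<noteq> 0"
      then consider "n \<ge> 1" | "- n \<ge> 1" by linarith
      then show False
      proof cases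
        case 1
        then have "l powi 1 \<le> l powi n" using l by (intro power_int_increasing) auto
        then have "l * Im (q $ 1) \<le> Im (\<gamma> q $ 1)"
          unfolding Im using pos by (intro mult_right_mono) auto
        moreover have "l * (2 * b / (1 + l)) < l * Im (q $ 1)"
          using q l by (intro mult_strict_left_mono) (auto simp: strip_def)
        ultimately show False using q by (auto simp: strip_def)
      next
        case 2
        then have "l powi 1 \<le> l powi (- n)" using l by (intro power_int_increasing) auto
        moreover have "Im (q $ 1) = l powi (- n) * Im (\<gamma> q $ 1)"
          using l by (simp add: Im power_int_minus)
        ultimately have "l * Im (\<gamma> q $ 1) \<le> Im (q $ 1)"
          using pos by (metis mult_right_mono order_less_imp_le power_int_1_right)
        moreover have "l * (2 * b / (1 + l)) < l * Im (\<gamma> q $ 1)"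
          using q l by (intro mult_strict_left_mono) (auto simp: strip_def)
        ultimately show False using q by (auto simp: strip_def)
      qed
    qed
    then have "\<gamma> = h" by (simp add: h(2))
    then show "\<gamma> = id" using W(4) h(1) q by (metis IntD1)
  qed
  then show "\<exists>W. open W \<and> p \<in> W \<and> W \<subseteq> UU \<and> (\<forall>g\<in>\<Gamma>. \<forall>q\<in>W. g q \<in> W \<longrightarrow> g = id)"
    using W \<open>open strip\<close> \<open>p \<in> strip\<close> by (intro exI [of _ "W \<inter> strip"]) blast
qed

text \<open>Freeness and discontinuity pass to subgroups, so it suffices to place the generators
  \<open>X\<close> in a discrete group \<Lambda> normalised by the scaling.\<close>

lemma generate_covering:
  assumes \<Lambda>: "subgroup \<Lambda> AffU" and X: "X \<subseteq> \<Lambda>" and l: "l > 1" and k: "k \<noteq> 0"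
    and left: "\<And>h. h \<in> \<Lambda> \<Longrightarrow> \<exists>h'\<in>\<Lambda>. tri l 0 k 0 t \<circ> h = h' \<circ> tri l 0 k 0 t"
    and right: "\<And>h. h \<in> \<Lambda> \<Longrightarrow> \<exists>h'\<in>\<Lambda>. h \<circ> tri l 0 k 0 t = tri l 0 k 0 t \<circ> h'"
    and fst: "\<And>h. h \<in> \<Lambda> \<Longrightarrow> \<exists>x::real. \<forall>p. h p $ 1 = p $ 1 + of_real x"
    and disc: "\<And>p. p \<in> UU \<Longrightarrow> \<exists>W. open W \<and> p \<in> W \<and> W \<subseteq> UU \<and> (\<forall>h\<in>\<Lambda>. \<forall>q\<in>W. h q \<in> W \<longrightarrow> h = id)"
  shows "covering_subgroup (generate AffU (insert (tri l 0 k 0 t) X))"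
proof -
  interpret group AffU by (rule group_AffU)
  let ?g = "tri l 0 k 0 t"
  have g: "?g \<in> carrier AffU" using l k by (intro tri_carrier) auto
  have sub: "insert ?g X \<subseteq> carrier AffU" using g X subgroup.subset [OF \<Lambda>] by blast
  have "generate AffU (insert ?g X) \<subseteq> generate AffU (insert ?g \<Lambda>)"
    using X by (intro mono_generate) blast
  also have "\<dots> \<subseteq> {h \<otimes>\<^bsub>AffU\<^esub> ?g [^]\<^bsub>AffU\<^esub> (n::int) |h n. h \<in> \<Lambda>}"
    using left right by (intro generate_insert_subset \<Lambda> g) simp_all
  finally have "\<exists>h\<in>\<Lambda>. \<exists>n::int. \<gamma> = h \<circ> (?g [^]\<^bsub>AffU\<^esub> n)"
    if "\<gamma> \<in> generate AffU (insert ?g X)" for \<gamma>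
    using that unfolding mult_AffU by blast
  then show ?thesis
    by (rule covering_subgroup_semidirect [OF generate_is_subgroup [OF sub] l k _ fst disc])
qed



section \<open>Integral matrices and integer lattices\<close>

lemma integral_mat_obtain:
  assumes "integral_mat A"
  obtains M :: "int^'n^'m" where "\<And>i j. A$i$j = of_int (M$i$j)"
proof -
  have "\<exists>z. A$i$j = of_int z" for i j
    using assms unfolding integral_mat_def by (metis Ints_cases)
  then obtain f where "\<And>i j. A$i$j = of_int (f i j)" by metis
  then show ?thesis by (intro that [of "\<chi> i j. f i j"]) simp
qed

lemma independent_columns_invertible:
  fixes P :: "'a::field^'n^'n"
  assumes inj: "inj (\<lambda>i. column i P)" and ind: "vec.independent (range (\<lambda>i. column i P))"
  shows "invertible P"
proof -
  have "c i = 0" if "(\<Sum>i\<in>UNIV. c i *s column i P) = 0" for c i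
  proof -
    have inv: "inv_into UNIV (\<lambda>i. column i P) (column i P) = i" for i
      using inv_f_f [OF inj, of i] .
    \<comment> \<open>Independence speaks of coefficients on vectors; injectivity of the columns
      converts coefficients on indices into these.\<close>
    let ?u = "\<lambda>v. c (inv_into UNIV (\<lambda>i. column i P) v)"
    have "(\<Sum>v\<in>range (\<lambda>i. column i P). ?u v *s v) = 0"
      using that by (simp add: sum.reindex [OF inj] inv)
    then have "?u (column i P) = 0"
      by (intro vec.independentD [OF ind]) auto
    then show ?thesis by (simp add: inv)
  qed
  then obtain B where "B ** P = mat 1"
    using matrix_left_invertible_independent_columns [of P] by auto
  then show ?thesis
    using matrix_left_right_inverse invertible_def by blast
qed

lemma conj_diag_mult:
  fixes P :: "'a::field^'n^'n"
  assumes "invertible P"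
  shows "conj_diag P d ** P = P ** diag_mat d"
proof -
  have "matrix_inv P ** P = mat 1"
    unfolding matrix_inv_def using assms unfolding invertible_def by (rule someI2_ex) simp
  then show ?thesis
    by (simp add: conj_diag_def matrix_mul_assoc [symmetric])
qed

text \<open>The form in which the conditions on N are used: column \<open>k\<close> of
  \<open>P\<close> is an eigenvector with eigenvalue \<open>d $ k\<close>.\<close>

lemma conj_diag_eigen:
  fixes P :: "'a::field^'n^'n"
  assumes "invertible P"
  shows "(\<Sum>j\<in>UNIV. conj_diag P d $ i $ j * P $ j $ k) = d $ k * P $ i $ k"
proof -
  have "(conj_diag P d ** P) $ i $ k = (P ** diag_mat d) $ i $ k"
    by (simp add: conj_diag_mult [OF assms])
  also have "\<dots> = d $ k * P $ i $ k"
    by (simp add: matrix_matrix_mult_def diag_mat_def if_distrib [of "\<lambda>x. _ * x"] cong: if_cong)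
  finally show ?thesis by (simp add: matrix_matrix_mult_def)
qed

text \<open>\<open>m\<close> plays the role of a vector of exponents: with v = a the value is the
  translation in w of a product of the generators with these exponents.\<close>

definition idot :: "int^'n \<Rightarrow> 'a::comm_ring_1^'n \<Rightarrow> 'a" where
  "idot m v = (\<Sum>i\<in>UNIV. of_int (m$i) * v$i)"

lemma idot_simps [simp]:
  "idot 0 v = 0" "idot (m + m') v = idot m v + idot m' v" "idot (- m) v = - idot m v"
  "idot (m - m') v = idot m v - idot m' v" "idot (k *s m) v = of_int k * idot m v"
  by (simp_all add: idot_def distrib_right sum.distrib left_diff_distrib sum_subtractf sum_negf
      sum_distrib_left mult.assoc)

lemma idot_axis [simp]: "idot (axis i 1) v = v$i"
proof -
  have "idot (axis i 1) v = (\<Sum>j\<in>UNIV. if j = i then v$j else 0)"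
    unfolding idot_def axis_def by (intro sum.cong) auto
  then show ?thesis by simp
qed

lemma idot_vector_matrix:
  "idot (m v* N) v = (\<Sum>i\<in>UNIV. of_int (m$i) * (\<Sum>j\<in>UNIV. of_int (N$i$j) * v$j))"
proof -
  have "idot (m v* N) v = (\<Sum>j\<in>UNIV. \<Sum>i\<in>UNIV. of_int (m$i) * (of_int (N$i$j) * v$j))"
    by (simp add: idot_def vector_matrix_mult_def sum_distrib_right sum_distrib_left mult_ac)
  also have "\<dots> = (\<Sum>i\<in>UNIV. \<Sum>j\<in>UNIV. of_int (m$i) * (of_int (N$i$j) * v$j))"
    by (rule sum.swap)
  finally show ?thesis by (simp add: sum_distrib_left)
qed

text \<open>Scaling multiplies translation parts by eigenvalues; this realises it on exponents, by
  the integer matrix \<open>N\<close> acting on rows.\<close>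

lemma idot_eigen:
  assumes "\<And>i. (\<Sum>j\<in>UNIV. of_int (N$i$j) * v$j) = \<mu> * v$i"
  shows "idot (m v* N) v = \<mu> * idot m v"
  unfolding idot_vector_matrix assms by (simp add: idot_def sum_distrib_left mult_ac)

text \<open>The inverse of \<open>R\<close> recovers \<open>m\<close> from the values of the forms.
  If these are all small, every entry of \<open>m\<close> has absolute value below 1 and, being an
  integer, is 0.\<close>

lemma integer_lattice_discrete:
  fixes R :: "'a::real_normed_field^'n^'n"
  assumes "invertible R"
  obtains \<epsilon> where "\<epsilon> > 0" "\<And>m. (\<And>i. norm (idot m (R$i)) < \<epsilon>) \<Longrightarrow> m = 0"
proof -
  obtain Q where Q: "Q ** R = mat 1" using assms by (auto simp: invertible_def)
  \<comment> \<open>\<open>C\<close> dominates every row sum of \<open>Q\<close>, and C / (1 + C) <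
    1 gives the strict bound.\<close>
  define C where "C = (\<Sum>i\<in>UNIV. \<Sum>j\<in>UNIV. norm (Q$i$j))"
  have C: "0 \<le> C" unfolding C_def by (intro sum_nonneg) auto
  have "m = 0" if m: "\<And>i. norm (idot m (R$i)) < 1 / (1 + C)" for m
  proof -
    have "m $ i = 0" for i
    proof -
      have "Q *v (\<chi> i. idot m (R$i)) = Q *v (R *v (\<chi> i. of_int (m$i)))"
        by (simp add: idot_def matrix_vector_mult_def mult.commute)
      also have "\<dots> = (\<chi> i. of_int (m$i))"
        by (simp add: matrix_vector_mul_assoc Q)
      finally have "of_int (m$i) = (\<Sum>j\<in>UNIV. Q$i$j * idot m (R$j))"
        by (simp add: vec_eq_iff matrix_vector_mult_def)
      then have "norm (of_int (m$i) :: 'a) \<le> (\<Sum>j\<in>UNIV. norm (Q$i$j) * norm (idot m (R$j)))"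
        by (simp add: norm_mult order_trans [OF norm_sum])
      also have "\<dots> \<le> (\<Sum>j\<in>UNIV. norm (Q$i$j) * (1 / (1 + C)))"
        using m by (intro sum_mono mult_left_mono) (auto intro: less_imp_le)
      also have "\<dots> = (\<Sum>j\<in>UNIV. norm (Q$i$j)) * (1 / (1 + C))"
        by (simp add: sum_divide_distrib)
      also have "\<dots> \<le> C * (1 / (1 + C))"
        unfolding C_def
        by (intro mult_right_mono member_le_sum [of i UNIV "\<lambda>i. \<Sum>j\<in>UNIV. norm (Q$i$j)"])
          (use C in \<open>auto simp: C_def intro!: sum_nonneg\<close>)
      also have "\<dots> < 1" using C by (simp add: field_simps)
      finally show ?thesis by simp
    qed
    then show ?thesis by (simp add: vec_eq_iff)
  qed
  then show ?thesis using C by (intro that [of "1 / (1 + C)"]) auto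
qed

text \<open>All that rigidity uses of a group: discontinuity and the two elements that together
  produce small periods. This makes the three types uniform.\<close>

definition regular_group :: "(complex^2 \<Rightarrow> complex^2) set \<Rightarrow> bool" where
  "regular_group \<Gamma> \<longleftrightarrow> covering_subgroup \<Gamma> \<and>
     (\<exists>x n s. x \<noteq> 0 \<and> tri 1 x 1 n s \<in> \<Gamma>) \<and>
     (\<exists>l k t. l > 1 \<and> k \<noteq> 0 \<and> k \<noteq> of_real (l\<^sup>2) \<and> tri l 0 k 0 t \<in> \<Gamma>)"

lemma subgroup_AffU_I:
  assumes "\<Lambda> \<subseteq> carrier AffU" "id \<in> \<Lambda>"
    and "\<And>g h. g \<in> \<Lambda> \<Longrightarrow> h \<in> \<Lambda> \<Longrightarrow> g \<circ> h \<in> \<Lambda>" "\<And>g. g \<in> \<Lambda> \<Longrightarrow> \<exists>h\<in>\<Lambda>. h \<circ> g = id"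
  shows "subgroup \<Lambda> AffU"
proof -
  interpret group AffU by (rule group_AffU)
  show ?thesis
  proof (rule subgroupI)
    fix g assume g: "g \<in> \<Lambda>"
    then obtain h where "h \<in> \<Lambda>" "h \<circ> g = id" using assms(4) by blast
    then have "inv_AffU g = h" using assms(1) g by (intro inv_equality) auto
    with \<open>h \<in> \<Lambda>\<close> show "inv_AffU g \<in> \<Lambda>" by simp
  qed (use assms in auto)
qed

lemma norm_nth_diff_lt:
  fixes p q q' :: "complex^2"
  assumes "q \<in> ball p \<rho>" "q' \<in> ball p \<rho>"
  shows "norm (q' $ i - q $ i) < 2 * \<rho>"
proof -
  have "norm (q' $ i - q $ i) \<le> dist q' q"
    using Finite_Cartesian_Product.norm_nth_le [of "q' - q" i] by (simp add: dist_norm)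
  also have "\<dots> < 2 * \<rho>"
    using assms dist_triangle [of q' q p] by (simp add: dist_commute)
  finally show ?thesis .
qed

section \<open>Type I: a group of translations\<close>

lemma group_I_regular:
  assumes adm: "admissible \<beta>" and comp: "compatible \<beta> a b"
  shows "regular_group (group_I \<beta> a b)"
proof -
  define l where "l = 1 / (cmod \<beta>)\<^sup>2"
  have "\<beta> \<noteq> 0" "cmod \<beta> < 1" using adm by (auto simp: admissible_def)
  then have l: "1 < l"
    by (simp add: l_def power_less_one_iff)
  obtain \<theta>1 \<theta>2 :: int where roots: "{x. poly [:-1, of_int \<theta>1, - of_int \<theta>2, 1:] x = 0} =
      {of_real l, \<beta>, cnj \<beta>}"
    using adm by (auto simp: admissible_def l_def)
  \<comment> \<open>The cubic equation in the form x q(x) = 1: the inverse of each eigenvalue is an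
    integer polynomial in it.\<close>
  have root: "x * (x * x - of_int \<theta>2 * x + of_int \<theta>1) = 1" if "x \<in> {of_real l, \<beta>, cnj \<beta>}" for x :: complex
  proof -
    have "poly [:-1, of_int \<theta>1, - of_int \<theta>2, 1:] x = 0"
      using that unfolding roots [symmetric] by simp
    then show ?thesis by (simp add: algebra_simps eq_neg_iff_add_eq_0)
  qed
  have root_l: "l * (l * l - of_int \<theta>2 * l + of_int \<theta>1) = 1"
  proof -
    have "complex_of_real (l * (l * l - of_int \<theta>2 * l + of_int \<theta>1)) = of_real 1"
      using root [of "of_real l"] by simp
    then show ?thesis unfolding of_real_eq_iff .
  qed

  define R :: "complex^3^3" where "R = vector (compatible_columns a b)"
  have R: "R $ 1 = (\<chi> i. of_real (a$i))" "R $ 2 = b" "R $ 3 = (\<chi> i. cnj (b$i))"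
    by (simp_all add: R_def compatible_columns_def)
  have row: "row i R = R $ i" for i
    by (simp add: row_def vec_eq_iff)
  have range: "range (\<lambda>i. R $ i) = set (compatible_columns a b)"
    unfolding UNIV_3 by (simp add: R compatible_columns_def)
  have ind: "lin_indep (compatible_columns a b)" using comp by (simp add: compatible_def)
  then have "inj (\<lambda>i. R $ i)"
    using R unfolding inj_def lin_indep_def compatible_columns_def forall_3 by auto
  then have P: "invertible (transpose R)"
    using ind range by (intro independent_columns_invertible) (simp_all add: row lin_indep_def)
  have R_inv: "invertible R" using P by (simp add: invertible_det_nz det_transpose)
  have a: "a \<noteq> 0"
  proof
    assume "a = 0"
    then have "0 \<in> set (compatible_columns a b)" by (simp add: compatible_columns_def vec_eq_iff)
    then show False using ind vec.dependent_zero unfolding lin_indep_def by blast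
  qed
  define d :: "complex^3" where "d = vector [of_real l, \<beta>, cnj \<beta>]"
  have "integral_mat (conj_diag (transpose R) d)"
    using comp by (simp add: compatible_def R_def d_def l_def)
  then obtain N :: "int^3^3" where N: "\<And>i j. conj_diag (transpose R) d $ i $ j = of_int (N$i$j)"
    by (metis integral_mat_obtain)
  have eig: "(\<Sum>j\<in>UNIV. of_int (N$i$j) * R $ k $ j) = d $ k * R $ k $ i" for i k
    using conj_diag_eigen [OF P, of d i k] unfolding N by (simp add: transpose_def)
  have eig_b: "(\<Sum>j\<in>UNIV. of_int (N$i$j) * b $ j) = \<beta> * b $ i" for i
    using eig [of i 2] by (simp add: R d_def)
  have eig_a: "(\<Sum>j\<in>UNIV. of_int (N$i$j) * a $ j) = l * a $ i" for i
  proof -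
    have "complex_of_real (\<Sum>j\<in>UNIV. of_int (N$i$j) * a $ j) = of_real (l * a $ i)"
      using eig [of i 1] by (simp add: R d_def)
    then show ?thesis unfolding of_real_eq_iff .
  qed

  \<comment> \<open>The translation with exponent vector \<open>m\<close>; conjugation by the
    scaling acts on exponents by \<open>N\<close>.\<close>
  define el where "el m = tri 1 (idot m a) 1 0 (idot m b)" for m
  have el_comp: "el m \<circ> el m' = el (m + m')" for m m'
    by (simp add: el_def tri_comp add_ac)
  have el_0: "el 0 = id" by (simp add: el_def tri_id)
  have \<Lambda>: "subgroup (range el) AffU"
  proof (rule subgroup_AffU_I)
    show "range el \<subseteq> carrier AffU" by (auto simp: el_def intro: tri_carrier)
    show "id \<in> range el" using el_0 by (metis rangeI)
    show "g \<circ> h \<in> range el" if "g \<in> range el" "h \<in> range el" for g h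
      using that by (auto simp: el_comp)
    show "\<exists>h\<in>range el. h \<circ> g = id" if "g \<in> range el" for g
    proof -
      from that obtain m where "g = el m" by blast
      then have "el (- m) \<circ> g = id" by (simp add: el_comp el_0)
      then show ?thesis by blast
    qed
  qed
  let ?g = "tri l 0 \<beta> 0 0"
  have comm: "?g \<circ> el m = el (m v* N) \<circ> ?g" for m
    by (simp add: el_def tri_comp idot_eigen [OF eig_a] idot_eigen [OF eig_b])
  have surj: "\<exists>m'. el (m' v* N) = el m" for m
  proof -
    \<comment> \<open>By the cubic equation, \<open>N\<^sup>2 - \<theta>2 N + \<theta>1\<close>
      inverts \<open>N\<close> on the pairings with a and b, and these determine
      \<open>el\<close>.\<close>
    let ?m = "(m v* N) v* N - \<theta>2 *s (m v* N) + \<theta>1 *s m"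
    have "idot (?m v* N) a = (l * (l * l - of_int \<theta>2 * l + of_int \<theta>1)) * idot m a"
      unfolding idot_eigen [OF eig_a] by (simp add: idot_eigen [OF eig_a] algebra_simps)
    moreover have "idot (?m v* N) b = (\<beta> * (\<beta> * \<beta> - of_int \<theta>2 * \<beta> + of_int \<theta>1)) * idot m b"
      unfolding idot_eigen [OF eig_b] by (simp add: idot_eigen [OF eig_b] algebra_simps)
    ultimately have "el (?m v* N) = el m"
      unfolding root_l root [of \<beta>, simplified] el_def by simp
    then show ?thesis by blast
  qed
  obtain \<epsilon> where \<epsilon>: "\<epsilon> > 0" "\<And>m. (\<And>i. norm (idot m (R$i)) < \<epsilon>) \<Longrightarrow> m = 0"
    using integer_lattice_discrete [OF R_inv] by metis
  have idot_R: "idot m (R $ 1) = of_real (idot m a)" "idot m (R $ 2) = idot m b"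
    "idot m (R $ 3) = cnj (idot m b)" for m
    by (simp_all add: R idot_def)
  have "covering_subgroup (generate AffU (insert ?g (range (\<lambda>i. tri 1 (a $ i) 1 0 (b $ i)))))"
  proof (rule generate_covering [OF \<Lambda> _ l \<open>\<beta> \<noteq> 0\<close>])
    show "range (\<lambda>i. tri 1 (a $ i) 1 0 (b $ i)) \<subseteq> range el"
    proof clarify
      fix i :: 3
      have "el (axis i 1) = tri 1 (a $ i) 1 0 (b $ i)" by (simp add: el_def)
      then show "tri 1 (a $ i) 1 0 (b $ i) \<in> range el" by (metis rangeI)
    qed
    show "\<exists>h'\<in>range el. ?g \<circ> h = h' \<circ> ?g" if "h \<in> range el" for h
      using that comm by blast
    show "\<exists>h'\<in>range el. h \<circ> ?g = ?g \<circ> h'" if "h \<in> range el" for h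
      using that comm surj by (metis (no_types, lifting) imageE rangeI)
    show "\<exists>x::real. \<forall>p. h p $ 1 = p $ 1 + of_real x" if "h \<in> range el" for h
      using that by (auto simp: el_def)
    fix p :: "complex^2" assume p: "p \<in> UU"
    \<comment> \<open>The displacement of \<open>q\<close> bounds the pairings of \<open>m\<close>
      with a and b, and by conjugation the one with the third row of \<open>R\<close>.\<close>
    have "el m = id" if q: "q \<in> ball p (\<epsilon> / 2)" "el m q \<in> ball p (\<epsilon> / 2)" for m q
    proof -
      have "norm (complex_of_real (idot m a)) < \<epsilon>" "norm (idot m b) < \<epsilon>"
        using norm_nth_diff_lt [OF q, of 1] norm_nth_diff_lt [OF q, of 2] by (simp_all add: el_def)
      then have "norm (idot m (R $ i)) < \<epsilon>" for i
        using exhaust_3 [of i] by (auto simp: idot_R)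
      then show ?thesis using \<epsilon>(2) el_0 by metis
    qed
    then show "\<exists>W. open W \<and> p \<in> W \<and> W \<subseteq> UU \<and> (\<forall>h\<in>range el. \<forall>q\<in>W. h q \<in> W \<longrightarrow> h = id)"
      using p \<epsilon>(1) open_UU by (intro exI [of _ "UU \<inter> ball p (\<epsilon> / 2)"]) auto
  qed
  moreover have "(\<lambda>p. vector [of_real (1 / (cmod \<beta>)\<^sup>2) * p$1, \<beta> * p$2]) = ?g"
    by (simp add: tri_def l_def)
  moreover have "(\<lambda>p. vector [p$1 + of_real (a$i), p$2 + b$i]) = tri 1 (a $ i) 1 0 (b $ i)" for i
    by (simp add: tri_def)
  ultimately have group: "group_I \<beta> a b = generate AffU (insert ?g (range (\<lambda>i. tri 1 (a $ i) 1 0 (b $ i))))"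
    and "covering_subgroup (group_I \<beta> a b)"
    by (simp_all add: group_I_def)
  moreover obtain i where "a $ i \<noteq> 0" using a by (auto simp: vec_eq_iff)
  moreover have "tri 1 (a $ i) 1 0 (b $ i) \<in> group_I \<beta> a b" "?g \<in> group_I \<beta> a b"
    unfolding group by (auto intro: generate.incl)
  \<comment> \<open>The moduli differ: |\<beta>| < 1 < l^2.\<close>
  moreover have "\<beta> \<noteq> of_real (l\<^sup>2)"
  proof
    assume "\<beta> = of_real (l\<^sup>2)"
    then have "cmod \<beta> = l\<^sup>2" by (metis abs_power2 norm_of_real)
    then show False using \<open>cmod \<beta> < 1\<close> l by (simp add: power2_eq_square) (smt (verit) mult_less_cancel_right2)
  qed
  ultimately show ?thesis
    using l \<open>\<beta> \<noteq> 0\<close> unfolding regular_group_def by blast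
qed

section \<open>Types II and III: lattices in the Heisenberg group\<close>

locale heisenberg_lattice =
  fixes a b c :: "real^2" and r :: nat and N :: "int^2^2" and l :: real and e :: int
    and t :: complex and k :: "int^2" and d :: "real^2" and \<delta> :: real
  assumes l: "l > 1" and e: "e = 1 \<or> e = -1" and r: "r \<ge> 1"
    and d_def: "d = (\<chi> i. c$i - a$i * b$i / 2)"
    and \<delta>_def: "\<delta> = b$1 * a$2 - b$2 * a$1" and \<delta>: "\<delta> \<noteq> 0"
    and eig_a: "\<And>i. (\<Sum>j\<in>UNIV. of_int (N$i$j) * a$j) = l * a$i"
    and eig_b: "\<And>i. (\<Sum>j\<in>UNIV. of_int (N$i$j) * b$j) = of_int e / l * b$i"
    and cond: "\<And>i. d$i - of_int e * (\<Sum>j\<in>UNIV. of_int (N$i$j) * d$j)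
      - of_int e * (\<delta> / 2) * of_int (N$i$1 * N$i$2) = \<delta> / r * of_int (k$i)"
begin

text \<open>In the coordinates x, y, s of the Heisenberg group of maps \<open>(w, z) \<mapsto> (w + x, z + y w + s)\<close>, the
  quantity \<open>s - x y / 2\<close> is additive up to half the commutator; the summand \<open>\<delta> / 2 m\<^sub>1 m\<^sub>2\<close> absorbs the
  resulting half-integers.\<close>

definition shift :: "int^2 \<Rightarrow> int \<Rightarrow> real" where
  "shift m j = idot m a * idot m b / 2 + idot m d + \<delta> / 2 * of_int (m$1 * m$2) + \<delta> / r * of_int j"

definition el :: "int^2 \<Rightarrow> int \<Rightarrow> complex^2 \<Rightarrow> complex^2" where
  "el m j = tri 1 (idot m a) 1 (of_real (idot m b)) (of_real (shift m j))"

lemma ee: "e * e = 1" "real_of_int e * real_of_int e = 1" "(of_int e :: complex) * of_int e = 1"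
  using e by auto

lemma idot_2: "idot (m :: int^2) v = of_int (m$1) * v$1 + of_int (m$2) * v$2"
  by (simp add: idot_def sum_2)

text \<open>Of the product (m.b)(m'.a) the symmetric part belongs to the term x y / 2, and the
  antisymmetric part is \<delta>/2 (m1 m2' - m2 m1'). Subtracting the change \<delta>/2 (m1 m2' + m2
  m1') of the quadratic term leaves -\<delta> m2 m1', an integer multiple of \<delta> / r.\<close>

lemma shift_add:
  "shift m j + shift m' j' + idot m b * idot m' a = shift (m + m') (j + j' - int r * (m$2 * m'$1))"
proof -
  have q: "\<delta> / r * of_int (j + j' - int r * (m$2 * m'$1)) =
      \<delta> / r * of_int j + \<delta> / r * of_int j' - \<delta> * of_int (m$2 * m'$1)"
    using r by (simp add: field_simps)
  show ?thesis
    unfolding shift_def q by (simp add: idot_2 \<delta>_def field_simps)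
qed

lemma el_comp: "el m j \<circ> el m' j' = el (m + m') (j + j' - int r * (m$2 * m'$1))"
  unfolding el_def tri_comp shift_add [symmetric] by (simp add: add_ac)

lemma el_0: "el 0 0 = id"
  by (simp add: el_def shift_def tri_id)

lemma el_carrier: "el m j \<in> carrier AffU"
  unfolding el_def by (rule tri_carrier) auto

definition lattice :: "(complex^2 \<Rightarrow> complex^2) set" where
  "lattice = {el m j |m j. True}"

lemma subgroup_lattice: "subgroup lattice AffU"
proof (rule subgroup_AffU_I)
  show "lattice \<subseteq> carrier AffU" using el_carrier by (auto simp: lattice_def)
  show "id \<in> lattice" unfolding lattice_def using el_0 by (metis (mono_tags) mem_Collect_eq)
  show "g \<circ> h \<in> lattice" if "g \<in> lattice" "h \<in> lattice" for g h
    using that unfolding lattice_def by (clarsimp simp: el_comp) blast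
  show "\<exists>h\<in>lattice. h \<circ> g = id" if "g \<in> lattice" for g
  proof -
    from that obtain m j where g: "g = el m j" by (auto simp: lattice_def)
    \<comment> \<open>By \<open>el_comp\<close> with first argument \<open>- m\<close>, the index on
      the left has to cancel \<open>j + int r * (m$2 * m$1)\<close>.\<close>
    have "el (- m) (- j - int r * (m$2 * m$1)) \<circ> g = id"
      by (simp add: g el_comp el_0)
    then show ?thesis unfolding lattice_def by blast
  qed
qed

text \<open>N multiplies a by l and b by e / l, hence the determinant \<delta> of the two vectors by
  e.\<close>

lemma det_N: "N$1$1 * N$2$2 - N$1$2 * N$2$1 = e"
proof -
  let ?n = "\<lambda>i j. real_of_int (N$i$j)"
  have A: "?n i 1 * a$1 + ?n i 2 * a$2 = l * a$i" and B: "?n i 1 * b$1 + ?n i 2 * b$2 = of_int e / l * b$i" for i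
    using eig_a [of i] eig_b [of i] by (simp_all add: sum_2)
  have "(?n 1 1 * ?n 2 2 - ?n 1 2 * ?n 2 1) * \<delta> =
      (?n 1 1 * b$1 + ?n 1 2 * b$2) * (?n 2 1 * a$1 + ?n 2 2 * a$2)
      - (?n 2 1 * b$1 + ?n 2 2 * b$2) * (?n 1 1 * a$1 + ?n 1 2 * a$2)"
    by (simp add: \<delta>_def algebra_simps)
  also have "\<dots> = of_int e * \<delta>"
    unfolding A B using l by (simp add: \<delta>_def field_simps)
  finally have "?n 1 1 * ?n 2 2 - ?n 1 2 * ?n 2 1 = of_int e" using \<delta> by simp
  then have "real_of_int (N$1$1 * N$2$2 - N$1$2 * N$2$1) = real_of_int e" by simp
  then show ?thesis unfolding of_int_eq_iff .
qed

lemma vector_matrix_2: "(m v* N) $ j = m$1 * N$1$j + m$2 * N$2$j"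
  by (simp add: vector_matrix_mult_def sum_2 mult.commute)

lemma N_surj:
  obtains m' where "m' v* N = m"
proof (rule that)
  \<comment> \<open>The adjugate of \<open>N\<close> divided by its determinant; since
    \<open>e\<close> is 1 or -1, multiplication by \<open>e\<close> does this over the
    integers.\<close>
  show "(e *s vector [m$1 * N$2$2 - m$2 * N$2$1, m$2 * N$1$1 - m$1 * N$1$2]) v* N = m"
  proof -
    have "e * ((m$1 * N$2$2 - m$2 * N$2$1) * N$1$1 + (m$2 * N$1$1 - m$1 * N$1$2) * N$2$1) =
        e * (N$1$1 * N$2$2 - N$1$2 * N$2$1) * m$1"
      "e * ((m$1 * N$2$2 - m$2 * N$2$1) * N$1$2 + (m$2 * N$1$1 - m$1 * N$1$2) * N$2$2) =
        e * (N$1$1 * N$2$2 - N$1$2 * N$2$1) * m$2"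
      by (simp_all add: algebra_simps)
    then show ?thesis
      unfolding det_N ee by (simp add: vec_eq_iff forall_2 vector_matrix_2 algebra_simps)
  qed
qed

text \<open>The change of the central index forced by \<open>shift_matrix\<close>. Halves of m1^2
  and of -m1, from the product of the new exponents and from \<open>cond\<close>, combine into m1
  (m1 - 1) / 2, and likewise for m2; this keeps the index integral.\<close>

definition index_shift :: "int^2 \<Rightarrow> int" where
  "index_shift m = e * (m$1 * k$1 + m$2 * k$2) - int r * ((m$1 * (m$1 - 1) div 2) * (N$1$1 * N$1$2)
     + (m$2 * (m$2 - 1) div 2) * (N$2$1 * N$2$2) + m$1 * m$2 * (N$1$2 * N$2$1))"

text \<open>The condition on c enters here: \<open>cond\<close> expresses the product of N and d
  through d, up to a multiple of \<delta> / r and \<delta> / 2 times a product of two entries. The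
  latter supplies the linear half of the binomials in \<open>index_shift\<close>.\<close>

lemma shift_matrix: "shift (m v* N) (e * j + index_shift m) = of_int e * shift m j"
proof -
  have half: "real_of_int (x * (x - 1) div 2) = of_int x * (of_int x - 1) / 2" for x :: int
  proof -
    have "even (x * (x - 1))" by simp
    then have "real_of_int (x * (x - 1) div 2) = real_of_int (x * (x - 1)) / 2"
      by (metis of_int_numeral real_of_int_div)
    then show ?thesis by simp
  qed
  define n11 n12 n21 n22 m1 m2 E where "n11 = real_of_int (N$1$1)" and "n12 = real_of_int (N$1$2)"
    and "n21 = real_of_int (N$2$1)" and "n22 = real_of_int (N$2$2)"
    and "m1 = real_of_int (m$1)" and "m2 = real_of_int (m$2)" and "E = real_of_int e"
  note defs = this
  have EE: "E * E = 1" using ee by (simp add: defs)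
  \<comment> \<open>Replacing n11 n22 turns the mixed term of \<open>prod\<close> into E m1 m2 plus
    an even multiple of m1 m2, so the only half left is the one present in
    \<open>shift\<close>.\<close>
  have det: "n11 * n22 = E + n12 * n21"
  proof -
    have "real_of_int (N$1$1 * N$2$2) = real_of_int (e + N$1$2 * N$2$1)"
      by (simp flip: det_N)
    then show ?thesis by (simp add: defs)
  qed
  have prod: "real_of_int ((m v* N) $ 1 * (m v* N) $ 2) =
      m1\<^sup>2 * (n11 * n12) + m2\<^sup>2 * (n21 * n22) + m1 * m2 * (E + 2 * (n12 * n21))"
  proof -
    have "real_of_int ((m v* N) $ 1 * (m v* N) $ 2) = (m1 * n11 + m2 * n21) * (m1 * n12 + m2 * n22)"
      by (simp add: vector_matrix_2 defs)
    also have "\<dots> = m1\<^sup>2 * (n11 * n12) + m2\<^sup>2 * (n21 * n22) + m1 * m2 * (n11 * n22 + n12 * n21)"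
      by (simp add: algebra_simps power2_eq_square)
    finally show ?thesis by (simp add: det algebra_simps)
  qed
  define nd where "nd i = (\<Sum>j\<in>UNIV. of_int (N$i$j) * d$j)" for i
  \<comment> \<open>\<open>cond\<close> solved for \<open>nd i\<close> through multiplication by E,
    where E * E = 1.\<close>
  have nd: "nd i = E * d$i - \<delta> / 2 * of_int (N$i$1 * N$i$2) - E * (\<delta> / r * of_int (k$i))" for i
  proof -
    have "E * (d$i - E * nd i - E * (\<delta> / 2) * of_int (N$i$1 * N$i$2)) = E * (\<delta> / r * of_int (k$i))"
      using cond [of i] by (simp add: nd_def defs)
    moreover have "E * (d$i - E * nd i - E * (\<delta> / 2) * of_int (N$i$1 * N$i$2)) =
        E * d$i - (E * E) * nd i - (E * E) * (\<delta> / 2) * of_int (N$i$1 * N$i$2)"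
      by (simp add: algebra_simps)
    ultimately show ?thesis unfolding EE by simp
  qed
  have "idot (m v* N) d = m1 * nd 1 + m2 * nd 2"
    by (simp add: idot_vector_matrix sum_2 [of "\<lambda>i. of_int (m $ i) * _ i"] nd_def defs sum_2)
  also have "\<dots> = E * idot m d - \<delta> / 2 * (m1 * (n11 * n12) + m2 * (n21 * n22))
      - E * (\<delta> / r * (m1 * of_int (k$1) + m2 * of_int (k$2)))"
    unfolding nd by (simp add: idot_2 defs algebra_simps)
  finally have id: "idot (m v* N) d = \<dots>" .
  have ix: "\<delta> / r * of_int (e * j + index_shift m) = E * (\<delta> / r * of_int j)
      + E * (\<delta> / r * (m1 * of_int (k$1) + m2 * of_int (k$2)))
      - \<delta> * (m1 * (m1 - 1) / 2 * (n11 * n12) + m2 * (m2 - 1) / 2 * (n21 * n22) + m1 * m2 * (n12 * n21))"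
  proof -
    have "real_of_int (e * j + index_shift m) = E * of_int j + E * (m1 * of_int (k$1) + m2 * of_int (k$2))
      - r * (m1 * (m1 - 1) / 2 * (n11 * n12) + m2 * (m2 - 1) / 2 * (n21 * n22) + m1 * m2 * (n12 * n21))"
      unfolding index_shift_def of_int_add of_int_diff of_int_mult half by (simp add: defs)
    moreover have "\<delta> / r * (A + B - r * C) = \<delta> / r * A + \<delta> / r * B - \<delta> * C" for A B C :: real
      using r by (simp add: field_simps)
    ultimately show ?thesis by (simp only: mult.left_commute [of "\<delta> / r" E])
  qed
  have xy: "idot (m v* N) a * idot (m v* N) b = E * (idot m a * idot m b)"
    unfolding idot_eigen [OF eig_a] idot_eigen [OF eig_b] using l by (simp add: defs)
  have mm: "real_of_int (m$1 * m$2) = m1 * m2" by (simp add: defs)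
  show ?thesis
    unfolding shift_def xy id prod ix mm E_def [symmetric]
    by (simp add: field_simps power2_eq_square)
qed

abbreviation scaling :: "complex^2 \<Rightarrow> complex^2" where
  "scaling \<equiv> tri l 0 (of_int e) 0 t"

text \<open>Conjugation by the scaling multiplies the coordinates x, y, s by l, e / l and e;
  \<open>t\<close> occurs once on each side and cancels.\<close>

lemma scaling_comp: "scaling \<circ> el m j = el (m v* N) (e * j + index_shift m) \<circ> scaling"
  unfolding el_def shift_matrix using l
  by (simp add: tri_comp idot_eigen [OF eig_a] idot_eigen [OF eig_b] add.commute)

text \<open>The displacement of (w, z) by \<open>el m j\<close> is (m.a, (m.b) w + shift). The first
  entry bounds m.a, the imaginary part of the second bounds (m.b) Im w, and Im w stays away from 0;
  so m = 0, and the remaining displacement \<delta> j / r excludes j \<noteq> 0.\<close>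

lemma lattice_discrete:
  assumes p: "p \<in> UU"
  shows "\<exists>W. open W \<and> p \<in> W \<and> W \<subseteq> UU \<and> (\<forall>h\<in>lattice. \<forall>q\<in>W. h q \<in> W \<longrightarrow> h = id)"
proof -
  define R :: "real^2^2" where "R = vector [a, b]"
  have "invertible R"
    using \<delta> by (simp add: R_def invertible_det_nz det_2 \<delta>_def algebra_simps)
  then obtain \<epsilon> where \<epsilon>: "\<epsilon> > 0" "\<And>m. (\<And>i. norm (idot m (R$i)) < \<epsilon>) \<Longrightarrow> m = 0"
    using integer_lattice_discrete by metis
  define y0 where "y0 = Im (p $ 1)"
  have y0: "y0 > 0" using p by (simp add: y0_def UU_iff)
  define \<kappa> where "\<kappa> = \<bar>\<delta> / r\<bar>"
  have \<kappa>: "\<kappa> > 0" using \<delta> r by (simp add: \<kappa>_def)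
  \<comment> \<open>Coordinates of two points of the ball differ by less than 2 \<rho>. In order,
    the bounds keep Im w above y0 / 2, make |m.a| and |m.b| smaller than \<epsilon>, and make
    |\<delta> j / r| smaller than \<kappa>.\<close>
  define \<rho> where "\<rho> = Min {y0 / 2, \<epsilon> / 2, \<epsilon> * y0 / 4, \<kappa> / 2}"
  have "\<rho> \<le> y0 / 2" "\<rho> \<le> \<epsilon> / 2" "\<rho> \<le> \<epsilon> * y0 / 4" "\<rho> \<le> \<kappa> / 2"
    unfolding \<rho>_def by (rule Min_le; simp)+
  moreover have "0 < \<rho>"
    unfolding \<rho>_def using y0 \<epsilon>(1) \<kappa> by (subst Min_gr_iff) auto
  ultimately have \<rho>: "\<rho> \<le> y0 / 2" "2 * \<rho> \<le> \<epsilon>" "2 * \<rho> \<le> \<epsilon> * (y0 / 2)" "2 * \<rho> \<le> \<kappa>" "0 < \<rho>"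
    by simp_all
  have Im_q: "y0 / 2 < Im (q $ 1)" if "q \<in> ball p \<rho>" for q
  proof -
    have "\<bar>Im (p $ 1 - q $ 1)\<bar> \<le> norm ((p - q) $ 1)" using abs_Im_le_cmod [of "p $ 1 - q $ 1"] by simp
    also have "\<dots> \<le> norm (p - q)" by (rule Finite_Cartesian_Product.norm_nth_le)
    also have "\<dots> < \<rho>" using that by (simp add: dist_norm)
    finally show ?thesis using \<rho>(1) by (simp add: y0_def)
  qed
  have "el m j = id" if q: "q \<in> ball p \<rho>" "el m j q \<in> ball p \<rho>" for m j q
  proof -
    have 1: "\<bar>idot m a\<bar> < 2 * \<rho>" and 2: "norm (of_real (idot m b) * q $ 1 + of_real (shift m j)) < 2 * \<rho>"
      using norm_nth_diff_lt [OF q, of 1] norm_nth_diff_lt [OF q, of 2] by (simp_all add: el_def)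
    have "\<bar>idot m b\<bar> * (y0 / 2) \<le> \<bar>idot m b\<bar> * Im (q $ 1)"
      using Im_q [OF q(1)] by (intro mult_left_mono) auto
    also have "\<dots> = \<bar>Im (of_real (idot m b) * q $ 1 + of_real (shift m j))\<bar>"
      using Im_q [OF q(1)] y0 by (simp add: abs_mult)
    also have "\<dots> < 2 * \<rho>"
      using 2 abs_Im_le_cmod le_less_trans by blast
    also have "\<dots> \<le> \<epsilon> * (y0 / 2)" by (rule \<rho>)
    finally have "\<bar>idot m b\<bar> < \<epsilon>" using y0 by simp
    with 1 \<rho>(2) have "norm (idot m (R $ i)) < \<epsilon>" for i
      using exhaust_2 [of i] by (auto simp: R_def)
    then have m: "m = 0" using \<epsilon>(2) by metis
    have "norm (complex_of_real (\<delta> / r * of_int j)) < \<kappa>"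
      using 2 \<rho>(4) by (simp add: m shift_def)
    then have "\<kappa> * \<bar>of_int j\<bar> < \<kappa> * 1"
      unfolding norm_of_real by (simp add: abs_mult \<kappa>_def)
    then have "\<bar>real_of_int j\<bar> < 1"
      using \<kappa> by simp
    then have "j = 0" by linarith
    with m show ?thesis by (simp add: el_0)
  qed
  moreover have "ball p \<rho> \<subseteq> UU" using Im_q y0 by (force simp: UU_iff)
  ultimately show ?thesis
    using \<rho>(5) by (intro exI [of _ "ball p \<rho>"]) (auto simp: lattice_def)
qed

lemma unipotent_gens_tri:
  "unipotent_gens a b c r = insert (tri 1 0 1 0 (of_real (\<delta> / r)))
    (range (\<lambda>i::2. tri 1 (a$i) 1 (of_real (b$i)) (of_real (c$i))))"
  by (simp add: unipotent_gens_def tri_def wedge_def \<delta>_def add_ac)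

lemma regular: "regular_group (generate AffU (insert scaling (unipotent_gens a b c r)))"
proof -
  let ?G = "generate AffU (insert scaling (unipotent_gens a b c r))"
  \<comment> \<open>The quadratic term vanishes on unit vectors, and x y / 2 restores the half
    product of a and b that was subtracted from c to form d.\<close>
  have el_axis: "el (axis i 1) 0 = tri 1 (a$i) 1 (of_real (b$i)) (of_real (c$i))" for i
  proof -
    have 0: "axis i (1::int) $ 1 * axis i 1 $ 2 = 0"
      using exhaust_2 [of i] by (auto simp: axis_def)
    have "shift (axis i 1) 0 = c $ i"
      unfolding shift_def 0 by (simp add: d_def)
    then show ?thesis by (simp add: el_def)
  qed
  have gens: "unipotent_gens a b c r \<subseteq> lattice"
  proof -
    have "tri 1 0 1 0 (of_real (\<delta> / r)) = el 0 1" by (simp add: el_def shift_def)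
    then show ?thesis
      unfolding unipotent_gens_tri lattice_def el_axis [symmetric] by auto
  qed
  have "covering_subgroup ?G"
  proof (rule generate_covering [OF subgroup_lattice gens l])
    show "(of_int e :: complex) \<noteq> 0" using e by auto
    show "\<exists>h'\<in>lattice. scaling \<circ> h = h' \<circ> scaling" if "h \<in> lattice" for h
      using that scaling_comp unfolding lattice_def by blast
    show "\<exists>h'\<in>lattice. h \<circ> scaling = scaling \<circ> h'" if hl: "h \<in> lattice" for h
    proof -
      obtain m j where h: "h = el m j" using hl by (auto simp: lattice_def)
      obtain m' where m': "m' v* N = m" using N_surj by metis
      \<comment> \<open>The index is chosen so that \<open>scaling_comp\<close> returns
        \<open>j\<close>, by e * e = 1.\<close>
      have "e * (e * (j - index_shift m')) + index_shift m' = j"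
        using ee by (simp flip: mult.assoc)
      then have "h \<circ> scaling = scaling \<circ> el m' (e * (j - index_shift m'))"
        unfolding scaling_comp m' h by simp
      then show ?thesis by (auto simp: lattice_def)
    qed
    show "\<exists>x::real. \<forall>p. h p $ 1 = p $ 1 + of_real x" if "h \<in> lattice" for h
      using that by (auto simp: lattice_def el_def)
  qed (rule lattice_discrete)
  moreover have "a \<noteq> 0" using \<delta> by (auto simp: \<delta>_def)
  then obtain i where "a $ i \<noteq> 0" by (auto simp: vec_eq_iff)
  moreover have "tri 1 (a$i) 1 (of_real (b$i)) (of_real (c$i)) \<in> ?G" "scaling \<in> ?G"
    unfolding unipotent_gens_tri by (auto intro: generate.incl)
  moreover have "(of_int e :: complex) \<noteq> of_real (l\<^sup>2)"
  proof
    assume "(of_int e :: complex) = of_real (l\<^sup>2)"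
    then have "real_of_int e = l\<^sup>2" by (metis of_real_eq_iff of_real_of_int_eq)
    moreover have "1 < l\<^sup>2" using l by simp
    ultimately show False using e by auto
  qed
  moreover have "(of_int e :: complex) \<noteq> 0" using e by auto
  ultimately show ?thesis
    using l unfolding regular_group_def by blast
qed

end

section \<open>Types II and III as instances\<close>

lemma eigen_of_columns_2:
  fixes a b :: "real^2"
  assumes ind: "lin_indep [a, b]" and int: "integral_mat N"
    and N: "N = conj_diag (matrix_of_columns [a, b]) (vector [\<mu>, \<nu>])"
  obtains M :: "int^2^2" where "b \<and>\<^sub>w a \<noteq> 0" "\<And>i j. N$i$j = of_int (M$i$j)"
    "\<And>i. (\<Sum>j\<in>UNIV. of_int (M$i$j) * a$j) = \<mu> * a$i"
    "\<And>i. (\<Sum>j\<in>UNIV. of_int (M$i$j) * b$j) = \<nu> * b$i"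
proof -
  define R :: "real^2^2" where "R = vector [a, b]"
  have R: "R $ 1 = a" "R $ 2 = b" by (simp_all add: R_def)
  have row: "row i R = R $ i" for i
    by (simp add: row_def vec_eq_iff)
  have range: "range (\<lambda>i. R $ i) = set [a, b]"
    unfolding UNIV_2 by (simp add: R)
  have "inj (\<lambda>i. R $ i)"
    using ind R unfolding inj_def lin_indep_def forall_2 by auto
  then have P: "invertible (transpose R)"
    using ind range by (intro independent_columns_invertible) (simp_all add: row lin_indep_def)
  then have "invertible R" by (simp add: invertible_det_nz det_transpose)
  then have "b \<and>\<^sub>w a \<noteq> 0"
    by (simp add: invertible_det_nz det_2 R wedge_def mult.commute)
  moreover obtain M :: "int^2^2" where M: "\<And>i j. N$i$j = of_int (M$i$j)"
    using integral_mat_obtain [OF int] by metis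
  moreover have eig: "(\<Sum>j\<in>UNIV. of_int (M$i$j) * R $ k $ j) = vector [\<mu>, \<nu>] $ k * R $ k $ i" for i k
    using conj_diag_eigen [OF P, of "vector [\<mu>, \<nu>]" i k]
    unfolding M [symmetric] N R_def by (simp add: transpose_def)
  ultimately show ?thesis
    using eig [of _ 1] eig [of _ 2] by (intro that [of M]) (simp_all add: R)
qed

lemma inoue_II_regular:
  assumes "inoue_II \<Gamma>"
  shows "regular_group \<Gamma>"
proof -
  obtain \<theta> :: int and l a b c r t and N :: "real^2^2" and k :: "int^2" where
    \<theta>: "\<theta> \<ge> 3" and l: "l = (of_int \<theta> + sqrt ((of_int \<theta>)\<^sup>2 - 4)) / 2"
    and ind: "lin_indep [a, b]"
    and N: "N = conj_diag (matrix_of_columns [a, b]) (vector [l, 1 / l])" "integral_mat N"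
    and r: "r \<ge> 1"
    and k: "(mat 1 - N) *v (c - (1/2) *s (\<chi> i. a$i * b$i))
             - (b \<and>\<^sub>w a / 2) *s vector [N$1$1 * N$1$2, N$2$1 * N$2$2]
           = (b \<and>\<^sub>w a / of_nat r) *s (\<chi> i. of_int (k$i))"
    and \<Gamma>: "\<Gamma> = group_II l a b c r t"
    using assms unfolding inoue_II_def by (elim exE conjE) (rule that)
  obtain M :: "int^2^2" where M: "b \<and>\<^sub>w a \<noteq> 0" "\<And>i j. N$i$j = of_int (M$i$j)"
    "\<And>i. (\<Sum>j\<in>UNIV. of_int (M$i$j) * a$j) = l * a$i"
    "\<And>i. (\<Sum>j\<in>UNIV. of_int (M$i$j) * b$j) = (1 / l) * b$i"
    by (rule eigen_of_columns_2 [OF ind N(2,1)]) (rule that)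
  define d where "d = (\<chi> i. c$i - a$i * b$i / 2)"
  define s where "s = sqrt ((real_of_int \<theta>)\<^sup>2 - 4)"
  have "0 \<le> s" unfolding s_def
    using power_mono [of 3 "real_of_int \<theta>" 2] \<theta> by simp
  moreover have "3 \<le> real_of_int \<theta>" using \<theta> by simp
  ultimately have "2 < real_of_int \<theta> + s" by (smt (verit))
  then have "l > 1" by (simp add: l s_def)
  have nn: "vector [N$1$1 * N$1$2, N$2$1 * N$2$2] $ i = N$i$1 * N$i$2" for i :: 2
    using exhaust_2 [of i] by auto
  have d_eq: "c - (1/2) *s (\<chi> i. a$i * b$i) = d"
    by (simp add: d_def vec_eq_iff)
  have cond: "d$i - (\<Sum>j\<in>UNIV. N$i$j * d$j) - (b \<and>\<^sub>w a / 2) * (N$i$1 * N$i$2)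
      = b \<and>\<^sub>w a / of_nat r * of_int (k$i)" for i
    using arg_cong [OF k, of "\<lambda>v. v $ i"] unfolding d_eq
    by (simp add: nn matrix_vector_mult_diff_rdistrib) (simp add: matrix_vector_mult_def)
  \<comment> \<open>Type II is the case e = 1: b has eigenvalue 1 / l and the scaling leaves the
    coefficient of z equal to 1.\<close>
  interpret heisenberg_lattice a b c r M l 1 t k d "b \<and>\<^sub>w a"
  proof unfold_locales
    show "b \<and>\<^sub>w a = b$1 * a$2 - b$2 * a$1" by (simp add: wedge_def)
    show "d = (\<chi> i. c$i - a$i * b$i / 2)" by (fact d_def)
    show "(\<Sum>j\<in>UNIV. of_int (M$i$j) * a$j) = l * a$i" for i by (fact M(3))
    show "(\<Sum>j\<in>UNIV. of_int (M$i$j) * b$j) = of_int 1 / l * b$i" for i using M(4) by simp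
    show "d$i - of_int 1 * (\<Sum>j\<in>UNIV. of_int (M$i$j) * d$j)
        - of_int 1 * (b \<and>\<^sub>w a / 2) * of_int (M$i$1 * M$i$2) = b \<and>\<^sub>w a / r * of_int (k$i)" for i
      using cond [of i] unfolding M(2) by simp
  qed (use \<open>l > 1\<close> r M(1) in auto)
  have "(\<lambda>p. vector [of_real l * p$1, p$2 + t]) = tri l 0 (of_int 1) 0 t"
    by (simp add: tri_def)
  then show ?thesis
    using regular by (simp add: \<Gamma> group_II_def)
qed

lemma inoue_III_regular:
  assumes "inoue_III \<Gamma>"
  shows "regular_group \<Gamma>"
proof -
  obtain \<theta> :: int and l a b c r and N :: "real^2^2" and k :: "int^2" where
    \<theta>: "\<theta> \<ge> 1" and l: "l = (of_int \<theta> + sqrt ((of_int \<theta>)\<^sup>2 + 4)) / 2"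
    and ind: "lin_indep [a, b]"
    and N: "N = conj_diag (matrix_of_columns [a, b]) (vector [l, - (1 / l)])" "integral_mat N"
    and r: "r \<ge> 1"
    and k: "(mat 1 + N) *v (c - (1/2) *s (\<chi> i. a$i * b$i))
             - (a \<and>\<^sub>w b / 2) *s vector [N$1$1 * N$1$2, N$2$1 * N$2$2]
           = (a \<and>\<^sub>w b / of_nat r) *s (\<chi> i. of_int (k$i))"
    and \<Gamma>: "\<Gamma> = group_III l a b c r"
    using assms unfolding inoue_III_def by (elim exE conjE) (rule that)
  obtain M :: "int^2^2" where M: "b \<and>\<^sub>w a \<noteq> 0" "\<And>i j. N$i$j = of_int (M$i$j)"
    "\<And>i. (\<Sum>j\<in>UNIV. of_int (M$i$j) * a$j) = l * a$i"
    "\<And>i. (\<Sum>j\<in>UNIV. of_int (M$i$j) * b$j) = - (1 / l) * b$i"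
    by (rule eigen_of_columns_2 [OF ind N(2,1)]) (rule that)
  define d where "d = (\<chi> i. c$i - a$i * b$i / 2)"
  \<comment> \<open>The root is at least 2 and \<theta> at least 1, so l \<ge> 3/2.\<close>
  have "sqrt (2\<^sup>2) \<le> sqrt ((of_int \<theta>)\<^sup>2 + 4)"
    by (intro real_sqrt_le_mono) simp
  then have "l > 1" using \<theta> by (simp add: l)
  have nn: "vector [N$1$1 * N$1$2, N$2$1 * N$2$2] $ i = N$i$1 * N$i$2" for i :: 2
    using exhaust_2 [of i] by auto
  have d_eq: "c - (1/2) *s (\<chi> i. a$i * b$i) = d"
    by (simp add: d_def vec_eq_iff)
  have wedge: "a \<and>\<^sub>w b = - (b \<and>\<^sub>w a)" by (simp add: wedge_def)
  have cond: "d$i + (\<Sum>j\<in>UNIV. N$i$j * d$j) + (b \<and>\<^sub>w a / 2) * (N$i$1 * N$i$2)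
      = b \<and>\<^sub>w a / of_nat r * of_int ((- k)$i)" for i
    using arg_cong [OF k, of "\<lambda>v. v $ i"] unfolding d_eq wedge
    by (simp add: nn matrix_vector_mult_add_rdistrib) (simp add: matrix_vector_mult_def)
  \<comment> \<open>Type III is the case e = -1 with t = 0; as \<open>a \<and>\<^sub>w b\<close> is
    the negative of \<delta>, the integer vector \<open>k\<close> changes sign.\<close>
  interpret heisenberg_lattice a b c r M l "-1" 0 "- k" d "b \<and>\<^sub>w a"
  proof unfold_locales
    show "b \<and>\<^sub>w a = b$1 * a$2 - b$2 * a$1" by (simp add: wedge_def)
    show "d = (\<chi> i. c$i - a$i * b$i / 2)" by (fact d_def)
    show "(\<Sum>j\<in>UNIV. of_int (M$i$j) * a$j) = l * a$i" for i by (fact M(3))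
    show "(\<Sum>j\<in>UNIV. of_int (M$i$j) * b$j) = of_int (- 1) / l * b$i" for i using M(4) by simp
    show "d$i - of_int (- 1) * (\<Sum>j\<in>UNIV. of_int (M$i$j) * d$j)
        - of_int (- 1) * (b \<and>\<^sub>w a / 2) * of_int (M$i$1 * M$i$2) = b \<and>\<^sub>w a / r * of_int ((- k)$i)" for i
      using cond [of i] unfolding M(2) by simp
  qed (use \<open>l > 1\<close> r M(1) in auto)
  have "(\<lambda>p. vector [of_real l * p$1, - p$2]) = tri l 0 (of_int (- 1)) 0 0"
    by (simp add: tri_def)
  then show ?thesis
    using regular by (simp add: \<Gamma> group_III_def)
qed

lemma inoue_group_regular:
  assumes "inoue_group \<Gamma>"
  shows "regular_group \<Gamma>"
  using assms unfolding inoue_group_def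
proof (elim disjE)
  assume "inoue_I \<Gamma>"
  then show ?thesis unfolding inoue_I_def by (elim exE conjE) (simp add: group_I_regular)
qed (simp_all add: inoue_II_regular inoue_III_regular)

section \<open>Conjugacy\<close>

text \<open>\<open>h1\<close> and \<open>h2\<close> are arbitrary triangular maps, which is all that
  \<open>equivariant_fibred_affine\<close> asks of the target. That the affine extension maps
  \<open>UU\<close> onto itself comes from \<Psi>.\<close>

lemma lift_affine:
  fixes \<Phi> \<Psi> :: "complex^2 \<Rightarrow> complex^2"
  assumes reg: "regular_group \<Gamma>'" and \<Gamma>'': "\<Gamma>'' \<subseteq> carrier AffU"
    and \<Phi>: "\<And>p. p \<in> UU \<Longrightarrow> \<Phi> p \<in> UU" "\<And>p. p \<in> UU \<Longrightarrow> complex_differentiable_at \<Phi> p"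
    and \<Psi>: "\<And>p. p \<in> UU \<Longrightarrow> \<Psi> p \<in> UU" "\<And>p. p \<in> UU \<Longrightarrow> complex_differentiable_at \<Psi> p"
    and inv: "\<And>p. p \<in> UU \<Longrightarrow> \<Psi> (\<Phi> p) = p" "\<And>p. p \<in> UU \<Longrightarrow> \<Phi> (\<Psi> p) = p"
    and equi: "\<And>g. g \<in> \<Gamma>' \<Longrightarrow> \<exists>h\<in>\<Gamma>''. \<forall>p\<in>UU. \<Phi> (g p) = h (\<Phi> p)"
  obtains g where "g \<in> carrier AffU" "\<And>p. p \<in> UU \<Longrightarrow> \<Phi> p = g p"
proof -
  obtain \<phi> A B where hol: "\<phi> holomorphic_on {w. 0 < Im w}" "A holomorphic_on {w. 0 < Im w}"
      "B holomorphic_on {w. 0 < Im w}" and inj: "inj_on \<phi> {w. 0 < Im w}"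
    and A: "\<And>w. 0 < Im w \<Longrightarrow> A w \<noteq> 0"
    and fib: "\<And>w z. 0 < Im w \<Longrightarrow> \<Phi> (vector [w, z]) = vector [\<phi> w, A w * z + B w]"
    using automorphism_fibred [OF \<Phi> \<Psi> inv] by blast
  obtain x n s where x: "x \<noteq> 0" "tri 1 x 1 n s \<in> \<Gamma>'"
    using reg unfolding regular_group_def by blast
  obtain m \<kappa> t where m: "m > 1" "\<kappa> \<noteq> 0" "\<kappa> \<noteq> of_real (m\<^sup>2)" "tri m 0 \<kappa> 0 t \<in> \<Gamma>'"
    using reg unfolding regular_group_def by blast
  obtain h1 where h1: "h1 \<in> \<Gamma>''" "\<And>p. p \<in> UU \<Longrightarrow> \<Phi> (tri 1 x 1 n s p) = h1 (\<Phi> p)"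
    using equi [OF x(2)] by blast
  obtain h2 where h2: "h2 \<in> \<Gamma>''" "\<And>p. p \<in> UU \<Longrightarrow> \<Phi> (tri m 0 \<kappa> 0 t p) = h2 (\<Phi> p)"
    using equi [OF m(4)] by blast
  obtain l1 x1 k1 n1 r1 where t1: "l1 \<noteq> 0" "k1 \<noteq> 0"
    "\<And>p. h1 p = vector [l1 * p$1 + x1, k1 * p$2 + n1 * p$1 + r1]"
    by (rule AffU_triangular [OF subsetD [OF \<Gamma>'' h1(1)]]) (rule that)
  obtain l2 x2 k2 n2 r2 where t2: "l2 \<noteq> 0" "k2 \<noteq> 0"
    "\<And>p. h2 p = vector [l2 * p$1 + x2, k2 * p$2 + n2 * p$1 + r2]"
    by (rule AffU_triangular [OF subsetD [OF \<Gamma>'' h2(1)]]) (rule that)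
  have eq1: "\<Phi> (vector [w + of_real x, z + n * w + s]) =
      (let q = \<Phi> (vector [w, z]) in vector [l1 * q$1 + x1, k1 * q$2 + n1 * q$1 + r1])"
    if "0 < Im w" for w z
    using h1(2) [of "vector [w, z]"] that by (simp add: UU_iff t1(3) tri_def Let_def)
  have eq2: "\<Phi> (vector [of_real m * w, \<kappa> * z + t]) =
      (let q = \<Phi> (vector [w, z]) in vector [l2 * q$1 + x2, k2 * q$2 + n2 * q$1 + r2])"
    if "0 < Im w" for w z
    using h2(2) [of "vector [w, z]"] that by (simp add: UU_iff t2(3) tri_def Let_def)
  obtain u v A0 e f where uA: "u \<noteq> 0" "A0 \<noteq> 0"
    and aff: "\<And>p. p \<in> UU \<Longrightarrow> \<Phi> p = vector [u * p$1 + v, A0 * p$2 + e * p$1 + f]"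
    by (rule equivariant_fibred_affine [OF hol inj A fib x(1) m(1-3) t1(1,2) t2(1,2) eq1 eq2])
      (assumption | (rule that, assumption+))+
  define M :: "complex^2^2" where "M = vector [vector [u, 0], vector [e, A0]]"
  define g where "g = (\<lambda>p. M *v p + vector [v, f])"
  have g: "\<Phi> p = g p" if "p \<in> UU" for p
    using aff [OF that]
    by (simp add: g_def M_def vec_eq_iff forall_2 matrix_vector_mult_def sum_2 add_ac)
  have "g ` UU = UU"
  proof (intro equalityI subsetI)
    fix p assume "p \<in> UU"
    then have "p = g (\<Psi> p)" "\<Psi> p \<in> UU" using g \<Psi>(1) inv(2) by metis+
    then show "p \<in> g ` UU" by blast
  qed (use g \<Phi>(1) in force)
  moreover have "invertible M"
    using uA by (simp add: M_def invertible_det_nz det_2)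
  ultimately have "g \<in> carrier AffU"
    unfolding AffU_def g_def by auto
  with g show ?thesis using that by blast
qed

lemma conjugate_coset:
  assumes "g \<in> carrier AffU"
  shows "(g <#\<^bsub>AffU\<^esub> \<Gamma>) #>\<^bsub>AffU\<^esub> (inv_AffU g) = {g \<circ> h \<circ> inv_AffU g |h. h \<in> \<Gamma>}"
  by (auto simp: l_coset_def r_coset_def)

text \<open>Points of the quotient are orbits, so \<open>g\<close> acts on them by direct image;
  conjugation makes the image of an orbit an orbit.\<close>

lemma conjugate_imp_biholomorphic:
  assumes "conjugate_subgroups AffU \<Gamma>' \<Gamma>''"
  shows "biholomorphic (quotient_surface \<Gamma>') (quotient_surface \<Gamma>'')"
proof -
  obtain g where g: "g \<in> carrier AffU" and sub: "subgroup \<Gamma>' AffU" "subgroup \<Gamma>'' AffU"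
    and \<Gamma>'': "\<Gamma>'' = {g \<circ> h \<circ> inv_AffU g |h. h \<in> \<Gamma>'}"
    using assms by (auto simp: conjugate_subgroups_def conjugate_coset)
  interpret A: AffU_subgroup \<Gamma>' by (rule AffU_subgroup.intro) (fact sub)
  interpret B: AffU_subgroup \<Gamma>'' by (rule AffU_subgroup.intro) (fact sub)
  note inv_g = carrier_AffU_D(5,6) [OF g]
  have g_orbit: "g ` orbit_proj \<Gamma>' p = orbit_proj \<Gamma>'' (g p)" for p
    unfolding orbit_proj_def \<Gamma>'' Setcompr_eq_image image_image by (simp add: inv_g)
  have inv_orbit: "inv_AffU g ` orbit_proj \<Gamma>'' p = orbit_proj \<Gamma>' (inv_AffU g p)" for p
  proof -
    have "inv_AffU g ` orbit_proj \<Gamma>'' p = inv_AffU g ` g ` orbit_proj \<Gamma>' (inv_AffU g p)"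
      by (simp add: g_orbit inv_g)
    then show ?thesis by (simp add: image_image inv_g)
  qed
  have "holomorphic_map (quotient_surface \<Gamma>') (quotient_surface \<Gamma>'') ((`) g)"
    by (rule holomorphic_map_induced [OF sub g g_orbit])
  moreover have "holomorphic_map (quotient_surface \<Gamma>'') (quotient_surface \<Gamma>') ((`) (inv_AffU g))"
    by (rule holomorphic_map_induced [OF sub(2,1) carrier_AffU_D(4) [OF g] inv_orbit])
  moreover have "inv_AffU g ` g ` x = x" "g ` inv_AffU g ` x = x" for x
    by (simp_all add: image_image inv_g)
  ultimately show ?thesis
    unfolding biholomorphic_def by blast
qed

text \<open>Equivariance in both directions gives both inclusions. The relation
  \<open>f \<circ> g = h \<circ> f\<close> is first known on \<open>UU\<close>; since both sides are
  affine it holds on C^2 and can be solved for \<open>h\<close>.\<close>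

lemma biholomorphic_imp_conjugate:
  assumes reg: "regular_group \<Gamma>'" "regular_group \<Gamma>''"
    and bih: "biholomorphic (quotient_surface \<Gamma>') (quotient_surface \<Gamma>'')"
  shows "conjugate_subgroups AffU \<Gamma>' \<Gamma>''"
proof -
  have cov: "covering_subgroup \<Gamma>'" "covering_subgroup \<Gamma>''"
    using reg by (simp_all add: regular_group_def)
  interpret A: covering_subgroup \<Gamma>' by (fact cov)
  interpret B: covering_subgroup \<Gamma>'' by (fact cov)
  obtain \<Phi> \<Psi> where \<Phi>: "\<And>p. p \<in> UU \<Longrightarrow> \<Phi> p \<in> UU" "\<And>p. p \<in> UU \<Longrightarrow> complex_differentiable_at \<Phi> p"
    and \<Psi>: "\<And>p. p \<in> UU \<Longrightarrow> \<Psi> p \<in> UU" "\<And>p. p \<in> UU \<Longrightarrow> complex_differentiable_at \<Psi> p"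
    and inv: "\<And>p. p \<in> UU \<Longrightarrow> \<Psi> (\<Phi> p) = p" "\<And>p. p \<in> UU \<Longrightarrow> \<Phi> (\<Psi> p) = p"
    and equi: "\<And>g. g \<in> \<Gamma>' \<Longrightarrow> \<exists>h\<in>\<Gamma>''. \<forall>p\<in>UU. \<Phi> (g p) = h (\<Phi> p)"
      "\<And>h. h \<in> \<Gamma>'' \<Longrightarrow> \<exists>g\<in>\<Gamma>'. \<forall>p\<in>UU. \<Phi> (g p) = h (\<Phi> p)"
    by (rule biholomorphic_lift [OF cov bih]) (rule that)
  obtain f where f: "f \<in> carrier AffU" "\<And>p. p \<in> UU \<Longrightarrow> \<Phi> p = f p"
    using lift_affine [OF reg(1) _ \<Phi> \<Psi> inv equi(1)] B.in_carrier by blast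
  have comm: "h = f \<circ> g \<circ> inv_AffU f"
    if gh: "g \<in> \<Gamma>'" "h \<in> \<Gamma>''" "\<And>p. p \<in> UU \<Longrightarrow> \<Phi> (g p) = h (\<Phi> p)" for g h
  proof -
    have car: "f \<circ> g \<in> carrier AffU" "h \<circ> f \<in> carrier AffU"
      using monoid.m_closed [OF group.is_monoid [OF group_AffU]] f(1) gh A.in_carrier B.in_carrier
      by (metis mult_AffU)+
    have "f \<circ> g = h \<circ> f"
      using gh(3) f(2) A.maps_UU [OF gh(1)] by (intro AffU_eq_if_eq_on_UU car) simp
    then show ?thesis
      using carrier_AffU_D(6) [OF f(1)] by (simp add: fun_eq_iff)
  qed
  have "\<Gamma>'' = {f \<circ> g \<circ> inv_AffU f |g. g \<in> \<Gamma>'}"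
  proof (intro equalityI subsetI)
    fix h assume "h \<in> \<Gamma>''"
    then show "h \<in> {f \<circ> g \<circ> inv_AffU f |g. g \<in> \<Gamma>'}" using equi(2) comm by blast
  next
    fix h assume "h \<in> {f \<circ> g \<circ> inv_AffU f |g. g \<in> \<Gamma>'}"
    then obtain g where g: "g \<in> \<Gamma>'" "h = f \<circ> g \<circ> inv_AffU f" by blast
    obtain h' where "h' \<in> \<Gamma>''" "\<And>p. p \<in> UU \<Longrightarrow> \<Phi> (g p) = h' (\<Phi> p)"
      using equi(1) [OF g(1)] by blast
    then show "h \<in> \<Gamma>''" using comm [OF g(1)] g(2) by metis
  qed
  then have "\<Gamma>'' = (f <#\<^bsub>AffU\<^esub> \<Gamma>') #>\<^bsub>AffU\<^esub> (inv_AffU f)"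
    by (simp add: conjugate_coset [OF f(1)])
  then show ?thesis
    using f(1) A.subgroup B.subgroup by (auto simp: conjugate_subgroups_def)
qed

theorem corollary4p2:
  fixes \<Gamma>' \<Gamma>'' :: "(complex^2 \<Rightarrow> complex^2) set"
  assumes "inoue_group \<Gamma>'" and "inoue_group \<Gamma>''"
  shows "biholomorphic (quotient_surface \<Gamma>') (quotient_surface \<Gamma>'') \<longleftrightarrow>
           conjugate_subgroups AffU \<Gamma>' \<Gamma>''"
  using biholomorphic_imp_conjugate conjugate_imp_biholomorphic assms inoue_group_regular by blast

end
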